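(* Let $q>3$ be an odd prime power, $G=\mathbf{SL}(2,\mathbb{F}_q)$, $E=\mathbb{F}_{q^2}$, and write $\overline{x}=x^q$ for $x\in E$. Let $x\in E\setminus\mathbb{F}_q$ and let $g=c_8(x)=\begin{pmatrix}0&-1\\1&x+\overline{x}\end{pmatrix}$, with conjugacy class $\mathcal{C}_8$ in $G$. Then $c_8(x)$ and $c_8(x)^{-1}$ are conjugate in $G$. Moreover, let $T=\{c_8(x),c_8(x)^{-1}\}$ and let $\chi$ be a character of the centralizer $\mathcal{Z}_g$ with values in $k^\times$. If $\dim\mathfrak{B}(\mathcal{C}_8)<\infty$, where $\mathfrak{B}(\mathcal{C}_8)=\mathfrak{B}(V(g,\chi))$, then $\mathbf{q}_T=\begin{pmatrix}-1&-1\\-1&-1\end{pmatrix}$ (in particular, $c_8(x)$ has even order).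
   Context: $k$ is an algebraically closed field of characteristic $0$. The classes $\mathcal{C}_8$ of the elements $c_8(x)$, $x\in E\setminus\mathbb{F}_q$, are one of the types in the list of conjugacy classes of $\mathbf{SL}(2,\mathbb{F}_q)$, $q$ odd; this type is listed as consisting of $\frac{q-1}{2}$ classes, each of size $(q-1)q$ and with cyclic centralizer. For a finite group $G$, a Yetter-Drinfeld module over $kG$ is a $G$-graded $k$-vector space $V=\bigoplus_{h\in G}V_h$ with a linear $G$-action such that $g\cdot V_h\subseteq V_{ghg^{-1}}$. It is a braided vector space with braiding $c(v\otimes w)=h\cdot w\otimes v$ for $v\in V_h$, $w\in V$. For $g\in G$, $\mathcal{Z}_g$ is the centralizer of $g$ in $G$. For a character $\chi$ of $\mathcal{Z}_g$, $V(g,\chi)=\mathrm{Ind}_{\mathcal{Z}_g}^G\chi=kG\otimes_{k\mathcal{Z}_g}k_\chi$, graded so that $h\otimes w$ has degree $hgh^{-1}$. If $T=\{g_i\}$ is a set of pairwise commuting elements of the conjugacy class of $g$ that contains $g$, with $g_i=x_igx_i^{-1}$, then $\mathbf{q}_T=(\mathbf{q}_{ij})$ is the matrix with $\mathbf{q}_{ij}=\chi(x_j^{-1}g_ix_j)$ (independent of the choice of the $x_j$). On the span of the vectors $v_i=x_i\otimes1$ the braiding is $c(v_i\otimes v_j)=\mathbf{q}_{ij}v_j\otimes v_i$. The Nichols algebra of a braided vector space $(V,c)$ is $\mathfrak{B}(V)=T(V)/\bigoplus_{n\ge2}\ker(\mathfrak{S}_n)$, where $\mathfrak{S}_n=\sum_{\sigma\in\mathbb{S}_n}c_\sigma$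 acts on $V^{\otimes n}$ and $c_\sigma$ is obtained from a reduced expression of $\sigma$ by replacing each transposition $(i\ i{+}1)$ with $c$ acting on the factors $i,i+1$.
   Formalization: The element x is additionally assumed to have norm one (x times its conjugate is 1); for arbitrary x outside F_q the claim fails, e.g. q=7 and trace 2, where g is unipotent and not conjugate to its inverse. All classes of size q(q-1) are still covered. *)

theory Defs
  imports
    "HOL-Analysis.Analysis"
    "HOL-Algebra.Multiplicative_Group"
    "HOL-Combinatorics.Permutations"
    "HOL-Library.Poly_Mapping"
    "HOL-Computational_Algebra.Polynomial"
    "HOL-Computational_Algebra.Primes"
begin

section \<open>Free vector spaces\<close>

text \<open>The vector space over \<open>'k\<close> with basis \<open>B\<close> is the set of finitely supported functions
  with support in \<open>B\<close>; the basis vector of \<open>b\<close> is \<open>Poly_Mapping.single b 1\<close>.\<close>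

definition fscale :: "'k::field \<Rightarrow> ('b \<Rightarrow>\<^sub>0 'k) \<Rightarrow> ('b \<Rightarrow>\<^sub>0 'k)" where
  "fscale a p = Poly_Mapping.map ((*) a) p"

lemma lookup_fscale [simp]: "Poly_Mapping.lookup (fscale a p) b = a * Poly_Mapping.lookup p b"
  by (simp add: fscale_def Poly_Mapping.map.rep_eq when_def)

interpretation free_vs: vector_space "fscale :: 'k::field \<Rightarrow> ('b \<Rightarrow>\<^sub>0 'k) \<Rightarrow> ('b \<Rightarrow>\<^sub>0 'k)"
  by unfold_locales (auto intro!: poly_mapping_eqI simp: lookup_add algebra_simps)

text \<open>The linear map that sends each basis vector \<open>a\<close> to \<open>F a\<close>.\<close>

definition lin_ext :: "('a \<Rightarrow> ('b \<Rightarrow>\<^sub>0 'k::field)) \<Rightarrow> ('a \<Rightarrow>\<^sub>0 'k) \<Rightarrow> ('b \<Rightarrow>\<^sub>0 'k)" where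
  "lin_ext F p = (\<Sum>a\<in>Poly_Mapping.keys p. fscale (Poly_Mapping.lookup p a) (F a))"


section \<open>The Nichols algebra of a braided vector space\<close>

text \<open>\<open>V\<close> is given by a basis \<open>B\<close>. The words of length \<open>n\<close> over \<open>B\<close> are the induced basis
  of the \<open>n\<close>-th tensor power, the word \<open>[b\<^sub>1, \<dots>, b\<^sub>n]\<close> standing for the tensor product of the
  basis vectors \<open>b\<^sub>1, \<dots>, b\<^sub>n\<close>. The braiding is given by its values \<open>c a b\<close> on the basis of
  the tensor square, so that \<open>c a b\<close> is a combination of words of length two.\<close>

type_synonym ('b, 'k) tensor = "'b list \<Rightarrow>\<^sub>0 'k"

definition tensor_power :: "'b set \<Rightarrow> nat \<Rightarrow> ('b, 'k::field) tensor set" where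
  "tensor_power B n = {f. Poly_Mapping.keys f \<subseteq> {w \<in> lists B. length w = n}}"

definition tensor_algebra :: "'b set \<Rightarrow> ('b, 'k::field) tensor set" where
  "tensor_algebra B = {f. Poly_Mapping.keys f \<subseteq> lists B}"

text \<open>The braiding acting on the tensor factors \<open>i\<close> and \<open>i + 1\<close>, counted from \<open>0\<close>.\<close>

definition braid :: "('b \<Rightarrow> 'b \<Rightarrow> ('b, 'k::field) tensor) \<Rightarrow> nat \<Rightarrow> ('b, 'k) tensor \<Rightarrow> ('b, 'k) tensor"
  where
  "braid c i = lin_ext (\<lambda>w. lin_ext
     (\<lambda>u. Poly_Mapping.single (take i w @ u @ drop (i + 2) w) 1) (c (w ! i) (w ! Suc i)))"

text \<open>The symmetric group on \<open>n\<close> letters permutes \<open>{..<n}\<close>; the list \<open>[i\<^sub>1, \<dots>, i\<^sub>l]\<close> is read as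
  the product of the transpositions \<open>(i\<^sub>1 i\<^sub>1+1) \<circ> \<dots> \<circ> (i\<^sub>l i\<^sub>l+1)\<close>. The lift of a permutation to
  the tensor power does not depend on the reduced expression when \<open>c\<close> satisfies the braid
  equation.\<close>

definition transposition_prod :: "nat list \<Rightarrow> nat \<Rightarrow> nat" where
  "transposition_prod is = foldr (\<lambda>i p. Transposition.transpose i (Suc i) \<circ> p) is id"

definition reduced_expr :: "nat \<Rightarrow> (nat \<Rightarrow> nat) \<Rightarrow> nat list" where
  "reduced_expr n \<sigma> =
     (ARG_MIN length is. set is \<subseteq> {i. Suc i < n} \<and> transposition_prod is = \<sigma>)"

definition braid_perm ::
    "('b \<Rightarrow> 'b \<Rightarrow> ('b, 'k::field) tensor) \<Rightarrow> nat \<Rightarrow> (nat \<Rightarrow> nat) \<Rightarrow> ('b, 'k) tensor \<Rightarrow> ('b, 'k) tensor"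
  where "braid_perm c n \<sigma> = foldr (\<lambda>i F. braid c i \<circ> F) (reduced_expr n \<sigma>) id"

definition quantum_symmetrizer ::
    "('b \<Rightarrow> 'b \<Rightarrow> ('b, 'k::field) tensor) \<Rightarrow> nat \<Rightarrow> ('b, 'k) tensor \<Rightarrow> ('b, 'k) tensor"
  where "quantum_symmetrizer c n f = (\<Sum>\<sigma> | \<sigma> permutes {..<n}. braid_perm c n \<sigma> f)"

definition nichols_ideal ::
    "'b set \<Rightarrow> ('b \<Rightarrow> 'b \<Rightarrow> ('b, 'k::field) tensor) \<Rightarrow> ('b, 'k) tensor set"
  where "nichols_ideal B c =
     free_vs.span (\<Union>n\<in>{2..}. {f \<in> tensor_power B n. quantum_symmetrizer c n f = 0})"

definition nichols_algebra ::
    "'b set \<Rightarrow> ('b \<Rightarrow> 'b \<Rightarrow> ('b, 'k::field) tensor) \<Rightarrow> ('b, 'k) tensor set set"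
  where "nichols_algebra B c = tensor_algebra B //
     {(f, h). f \<in> tensor_algebra B \<and> h \<in> tensor_algebra B \<and> f - h \<in> nichols_ideal B c}"

text \<open>The quotient space is finite-dimensional iff it is spanned by the classes of finitely many
  tensors.\<close>

definition nichols_finite_dim ::
    "'b set \<Rightarrow> ('b \<Rightarrow> 'b \<Rightarrow> ('b, 'k::field) tensor) \<Rightarrow> bool"
  where "nichols_finite_dim B c \<longleftrightarrow>
     (\<exists>S. finite S \<and> S \<subseteq> tensor_algebra B \<and>
       (\<forall>X\<in>nichols_algebra B c. \<exists>f\<in>free_vs.span S. f \<in> X))"


section \<open>The Yetter-Drinfeld module \<open>V(g, \<chi>)\<close>\<close>

text \<open>A Yetter-Drinfeld module with a basis of homogeneous vectors: \<open>dg a\<close> is the degree of the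
  basis vector \<open>a\<close>, and \<open>act h b\<close> is the image of the basis vector \<open>b\<close> under \<open>h\<close>.\<close>

definition yd_braiding ::
    "('b \<Rightarrow> 'g) \<Rightarrow> ('g \<Rightarrow> 'b \<Rightarrow> ('b \<Rightarrow>\<^sub>0 'k::field)) \<Rightarrow> 'b \<Rightarrow> 'b \<Rightarrow> ('b, 'k) tensor"
  where "yd_braiding dg act a b = lin_ext (\<lambda>b'. Poly_Mapping.single [b', a] 1) (act (dg a) b)"

definition centralizer :: "('g, 'm) monoid_scheme \<Rightarrow> 'g \<Rightarrow> 'g set" where
  "centralizer G g = {h \<in> carrier G. h \<otimes>\<^bsub>G\<^esub> g = g \<otimes>\<^bsub>G\<^esub> h}"

definition conjugate_by :: "('g, 'm) monoid_scheme \<Rightarrow> 'g \<Rightarrow> 'g \<Rightarrow> 'g" where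
  "conjugate_by G h g = h \<otimes>\<^bsub>G\<^esub> g \<otimes>\<^bsub>G\<^esub> inv\<^bsub>G\<^esub> h"

definition units_group :: "'k::field monoid" where
  "units_group = \<lparr>carrier = UNIV - {0}, mult = (*), one = 1\<rparr>"

definition characters :: "('g, 'm) monoid_scheme \<Rightarrow> 'g set \<Rightarrow> ('g \<Rightarrow> 'k::field) set" where
  "characters G Z = hom (G\<lparr>carrier := Z\<rparr>) units_group"

text \<open>As a right module over \<open>kZ\<close>, \<open>kG\<close> is free on any set of representatives of the left cosets
  of \<open>Z\<close>. So the vectors \<open>r \<otimes> 1\<close>, with \<open>r\<close> a representative, are a basis of \<open>kG \<otimes>\<^bsub>kZ\<^esub> k\<^sub>\<chi>\<close>, and
  for \<open>h = r z\<close> one has \<open>h \<otimes> 1 = \<chi>(z) (r \<otimes> 1)\<close>; this is the vector \<open>induced_vec G Z \<chi> h\<close>.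
  The group acts by \<open>h \<cdot> (r \<otimes> 1) = h r \<otimes> 1\<close>.\<close>

definition coset_rep :: "('g, 'm) monoid_scheme \<Rightarrow> 'g set \<Rightarrow> 'g \<Rightarrow> 'g" where
  "coset_rep G Z h = (SOME r. r \<in> h <#\<^bsub>G\<^esub> Z)"

definition induced_basis :: "('g, 'm) monoid_scheme \<Rightarrow> 'g set \<Rightarrow> 'g set" where
  "induced_basis G Z = coset_rep G Z ` carrier G"

definition induced_vec ::
    "('g, 'm) monoid_scheme \<Rightarrow> 'g set \<Rightarrow> ('g \<Rightarrow> 'k::field) \<Rightarrow> 'g \<Rightarrow> ('g \<Rightarrow>\<^sub>0 'k)"
  where "induced_vec G Z chi h =
     Poly_Mapping.single (coset_rep G Z h) (chi (inv\<^bsub>G\<^esub> (coset_rep G Z h) \<otimes>\<^bsub>G\<^esub> h))"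

lemma induced_vec_mult_right:
  fixes G (structure) and chi :: "'g \<Rightarrow> 'k::field"
  assumes "group G" and Z: "subgroup Z G" and chi: "chi \<in> characters G Z"
    and h: "h \<in> carrier G" and z: "z \<in> Z"
  shows "induced_vec G Z chi (h \<otimes>\<^bsub>G\<^esub> z) = fscale (chi z) (induced_vec G Z chi h)"
proof -
  interpret group G by fact
  interpret Z: subgroup Z G by fact
  have zG: "z \<in> carrier G" using z by simp
  have "(h \<otimes> z) <# Z = h <# Z"
    using h zG z by (simp add: lcos_m_assoc[symmetric] Z.subset coset_join3 Z)
  then have rep: "coset_rep G Z (h \<otimes> z) = coset_rep G Z h"
    by (simp add: coset_rep_def)
  have "h \<in> h <# Z" using h Z.one_closed by (force simp: l_coset_def)
  then have "coset_rep G Z h \<in> h <# Z" unfolding coset_rep_def by (rule someI)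
  then obtain w where w: "w \<in> Z" "coset_rep G Z h = h \<otimes> w" by (auto simp: l_coset_def)
  then have "inv (coset_rep G Z h) \<otimes> h = inv w"
    using h by (simp add: inv_mult_group m_assoc)
  moreover have "inv (coset_rep G Z h) \<otimes> (h \<otimes> z) = inv w \<otimes> z"
    using calculation w h zG by (simp add: m_assoc[symmetric])
  moreover have "chi (inv w \<otimes> z) = chi (inv w) * chi z"
    using chi w z by (simp add: characters_def hom_def units_group_def)
  ultimately show ?thesis
    by (auto simp: induced_vec_def rep lookup_single when_def intro!: poly_mapping_eqI)
qed

definition V_basis :: "('g, 'm) monoid_scheme \<Rightarrow> 'g \<Rightarrow> 'g set" where
  "V_basis G g = induced_basis G (centralizer G g)"

definition V_braiding ::
    "('g, 'm) monoid_scheme \<Rightarrow> 'g \<Rightarrow> ('g \<Rightarrow> 'k::field) \<Rightarrow> 'g \<Rightarrow> 'g \<Rightarrow> ('g, 'k) tensor"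
  where "V_braiding G g chi =
     yd_braiding (\<lambda>r. conjugate_by G r g)
       (\<lambda>h r. induced_vec G (centralizer G g) chi (h \<otimes>\<^bsub>G\<^esub> r))"

text \<open>The matrix \<open>\<q>\<^sub>T\<close> of a family \<open>t\<close> of conjugates of \<open>g\<close>, where \<open>y\<close> is a family of
  conjugating elements: \<open>t $ i = y\<^sub>i g y\<^sub>i\<inverse>\<close>.\<close>

definition q_matrix ::
    "('g, 'm) monoid_scheme \<Rightarrow> ('g \<Rightarrow> 'k::field) \<Rightarrow> 'g ^ 'n \<Rightarrow> ('n \<Rightarrow> 'g) \<Rightarrow> 'k ^ 'n ^ 'n"
  where "q_matrix G chi t y = (\<chi> i j. chi (inv\<^bsub>G\<^esub> (y j) \<otimes>\<^bsub>G\<^esub> t $ i \<otimes>\<^bsub>G\<^esub> y j))"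


section \<open>The group \<open>SL(2, q)\<close> and the elements \<open>c\<^sub>8(x)\<close>\<close>

definition SL2 :: "('f::field ^ 2 ^ 2) monoid" where
  "SL2 = \<lparr>carrier = {A. det A = 1}, mult = (**), one = mat 1\<rparr>"

lemma group_SL2: "group SL2"
proof (rule groupI)
  fix A :: "'f::field ^ 2 ^ 2"
  assume "A \<in> carrier SL2"
  then have d: "det A = 1" by (simp add: SL2_def)
  then obtain B where B: "B ** A = mat 1"
    by (metis invertible_det_nz invertible_def zero_neq_one)
  then have "det B * det A = 1" by (metis det_mul det_I)
  then show "\<exists>B\<in>carrier SL2. B \<otimes>\<^bsub>SL2\<^esub> A = \<one>\<^bsub>SL2\<^esub>"
    using B d by (auto simp: SL2_def)
qed (auto simp: SL2_def det_mul matrix_mul_assoc)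

text \<open>\<open>\<iota>\<close> is the embedding of the field with \<open>q\<close> elements into the one with \<open>q\<^sup>2\<close> elements, and
  the lower right entry is the trace of \<open>x\<close>. The eigenvalues are \<open>x\<close> and its conjugate exactly
  when \<open>x\<close> has norm \<open>1\<close>, which is the normalization under which these matrices represent the
  classes of size \<open>q (q - 1)\<close>.\<close>

definition c8 :: "('f::finite_field \<Rightarrow> 'e::finite_field) \<Rightarrow> 'e \<Rightarrow> 'f ^ 2 ^ 2" where
  "c8 \<iota> x = vector [vector [0, -1], vector [1, the_inv \<iota> (x + x ^ CARD('f))]]"

end

theory Submission
  imports Defs "HOL-Combinatorics.Multiset_Permutations" "HOL-Number_Theory.Residues"
begin

text \<open>Put \<open>\<omega> = \<chi>(g)\<close>. Because \<open>g\<close> is conjugate to its inverse, \<open>V(g, \<chi>)\<close> contains a braided plane of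
  diagonal type with basis \<open>x, y\<close> and matrix entries \<open>q\<^sub>x\<^sub>x = q\<^sub>y\<^sub>y = \<omega>\<close> and \<open>q\<^sub>x\<^sub>y = q\<^sub>y\<^sub>x = \<omega>\<^sup>-\<^sup>1\<close>.
  On words in \<open>x, y\<close> the quantum symmetrizer is computed by iterated skew derivations
  \<open>\<partial>\<^sub>x, \<partial>\<^sub>y\<close>. The element \<open>u = x y - q\<^sub>x\<^sub>y y x\<close> is killed by \<open>\<partial>\<^sub>y\<close>, and its self-braiding
  \<open>q\<^sub>x\<^sub>x q\<^sub>x\<^sub>y q\<^sub>y\<^sub>x q\<^sub>y\<^sub>y\<close> is \<open>1\<close>, which gives
  \<open>(\<partial>\<^sub>y \<partial>\<^sub>x)\<^sup>n u\<^sup>n = n! (1 - q\<^sub>x\<^sub>y q\<^sub>y\<^sub>x)\<^sup>n\<close>. If \<open>\<omega>\<^sup>2 \<noteq> 1\<close> this is nonzero in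
  characteristic \<open>0\<close>, so that no power of \<open>u\<close> vanishes in the Nichols algebra; if \<open>\<omega> = 1\<close> no power
  of \<open>x\<close> does. Hence \<open>\<omega> = -1\<close> when the dimension is finite.\<close>

section \<open>Linear maps between free vector spaces\<close>

interpretation free_pair: vector_space_pair
  "fscale :: 'k::field \<Rightarrow> ('a \<Rightarrow>\<^sub>0 'k) \<Rightarrow> ('a \<Rightarrow>\<^sub>0 'k)"
  "fscale :: 'k \<Rightarrow> ('b \<Rightarrow>\<^sub>0 'k) \<Rightarrow> ('b \<Rightarrow>\<^sub>0 'k)"
  by unfold_locales

abbreviation linmap :: "(('a \<Rightarrow>\<^sub>0 'k::field) \<Rightarrow> ('b \<Rightarrow>\<^sub>0 'k)) \<Rightarrow> bool" where
  "linmap \<equiv> Vector_Spaces.linear fscale fscale"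

lemma linmap_iff:
  "linmap f \<longleftrightarrow> (\<forall>p r. f (p + r) = f p + f r) \<and> (\<forall>a p. f (fscale a p) = fscale a (f p))"
  by (simp add: Vector_Spaces.linear_iff free_vs.vector_space_axioms)

lemmas linmap_add = free_pair.linear_add
lemmas linmap_scale = free_pair.linear_scale
lemmas linmap_zero = free_pair.linear_0
lemmas linmap_diff = free_pair.linear_diff
lemmas linmap_sum = free_pair.linear_sum
lemmas linmapD = linmap_add linmap_scale

lemma linmap_comp: "linmap f \<Longrightarrow> linmap g \<Longrightarrow> linmap (\<lambda>p. f (g p))"
  by (simp add: linmap_iff)

lemma linmap_sum_fun: "(\<And>a. a \<in> A \<Longrightarrow> linmap (f a)) \<Longrightarrow> linmap (\<lambda>p. \<Sum>a\<in>A. f a p)"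
  by (auto simp: linmap_iff sum.distrib free_vs.scale_sum_right)

lemma linmap_add_fun: "linmap f \<Longrightarrow> linmap h \<Longrightarrow> linmap (\<lambda>p. f p + h p)"
  by (auto simp: linmap_iff free_vs.scale_right_distrib)

lemma linmap_scale_fun: "linmap f \<Longrightarrow> linmap (\<lambda>p. fscale a (f p))"
  by (auto simp: linmap_iff free_vs.scale_right_distrib mult.commute)

lemma fscale_single [simp]: "fscale a (Poly_Mapping.single b k) = Poly_Mapping.single b (a * k)"
  by (auto intro!: poly_mapping_eqI simp: lookup_single when_def)

lemma poly_mapping_eq_sum_singles:
  "(p :: 'a \<Rightarrow>\<^sub>0 'k::field) = (\<Sum>a\<in>Poly_Mapping.keys p. fscale (Poly_Mapping.lookup p a) (Poly_Mapping.single a 1))"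
  by (rule poly_mapping_eqI) (auto simp: lookup_sum lookup_single when_def in_keys_iff)

text \<open>The sum in \<open>lin_ext\<close> runs over the support of its argument. Over a common
  finite superset of several supports, linearity can be checked term by term.\<close>

lemma lin_ext_superset:
  assumes "finite A" "Poly_Mapping.keys p \<subseteq> A"
  shows "lin_ext F p = (\<Sum>a\<in>A. fscale (Poly_Mapping.lookup p a) (F a))"
  unfolding lin_ext_def using assms
  by (intro sum.mono_neutral_left) (auto simp: in_keys_iff)

lemma linmap_lin_ext: "linmap (lin_ext (F :: 'a \<Rightarrow> 'b \<Rightarrow>\<^sub>0 'k::field))"
unfolding linmap_iff
proof (intro conjI allI)
  fix p r :: "'a \<Rightarrow>\<^sub>0 'k" and a :: 'k
  let ?A = "Poly_Mapping.keys p \<union> Poly_Mapping.keys r"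
  have "finite ?A" "Poly_Mapping.keys (p + r) \<subseteq> ?A"
    using keys_add[of p r] by auto
  then show "lin_ext F (p + r) = lin_ext F p + lin_ext F r"
    by (simp add: lin_ext_superset[of ?A] lookup_add free_vs.scale_left_distrib sum.distrib)
  have "Poly_Mapping.keys (fscale a p) \<subseteq> Poly_Mapping.keys p"
    by (auto simp: in_keys_iff)
  then show "lin_ext F (fscale a p) = fscale a (lin_ext F p)"
    by (simp add: lin_ext_superset[of "Poly_Mapping.keys p"] free_vs.scale_sum_right)
qed

lemma lin_ext_single [simp]: "lin_ext F (Poly_Mapping.single a k) = fscale k (F a)"
  by (simp add: lin_ext_def)

lemma linmap_eq_lin_ext:
  assumes "linmap f"
  shows "f p = lin_ext (\<lambda>a. f (Poly_Mapping.single a 1)) p"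
proof -
  have "f p = f (\<Sum>a\<in>Poly_Mapping.keys p. fscale (Poly_Mapping.lookup p a) (Poly_Mapping.single a 1))"
    using poly_mapping_eq_sum_singles[of p] by simp
  also have "\<dots> = (\<Sum>a\<in>Poly_Mapping.keys p. fscale (Poly_Mapping.lookup p a) (f (Poly_Mapping.single a 1)))"
    unfolding linmap_sum[OF assms] linmap_scale[OF assms] ..
  finally show ?thesis by (simp only: lin_ext_def)
qed

lemma linmap_eqI:
  assumes "linmap f" "linmap h"
    and "\<And>a. a \<in> Poly_Mapping.keys p \<Longrightarrow> f (Poly_Mapping.single a 1) = h (Poly_Mapping.single a 1)"
  shows "f p = h p"
  unfolding linmap_eq_lin_ext[OF assms(1), of p] linmap_eq_lin_ext[OF assms(2), of p]
  using assms(3) by (simp add: lin_ext_def)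

lemma linmap_braid: "linmap (braid c i)"
  unfolding braid_def by (rule linmap_lin_ext)

lemma linmap_braid_perm: "linmap (braid_perm c n \<sigma>)"
proof -
  have "linmap (foldr (\<lambda>i F. braid c i \<circ> F) is id)" for "is"
    by (induction "is") (auto simp: o_def id_def linmap_iff linmapD[OF linmap_braid])
  then show ?thesis by (simp add: braid_perm_def)
qed

lemma linmap_quantum_symmetrizer: "linmap (quantum_symmetrizer c n)"
  unfolding quantum_symmetrizer_def by (intro linmap_sum_fun linmap_braid_perm)

section \<open>Finite-dimensional Nichols algebras\<close>

definition homogeneous_part :: "nat \<Rightarrow> ('b, 'k::field) tensor \<Rightarrow> ('b, 'k) tensor" where
  "homogeneous_part n = lin_ext (\<lambda>w. if length w = n then Poly_Mapping.single w 1 else 0)"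

lemma linmap_homogeneous_part: "linmap (homogeneous_part n)"
  unfolding homogeneous_part_def by (rule linmap_lin_ext)

lemma lookup_homogeneous_part:
  "Poly_Mapping.lookup (homogeneous_part n f) w = (if length w = n then Poly_Mapping.lookup f w else 0)"
proof -
  have "Poly_Mapping.lookup (homogeneous_part n f) w =
      (\<Sum>a\<in>Poly_Mapping.keys f. if a = w then (if length w = n then Poly_Mapping.lookup f w else 0) else 0)"
    unfolding homogeneous_part_def lin_ext_def lookup_sum
    by (rule sum.cong) (auto simp: lookup_single)
  then show ?thesis by (auto simp: in_keys_iff)
qed

lemma homogeneous_part_tensor_power:
  assumes "f \<in> tensor_power B m"
  shows "homogeneous_part n f = (if n = m then f else 0)"
  using assms by (intro poly_mapping_eqI)
    (auto simp: lookup_homogeneous_part tensor_power_def in_keys_iff subset_iff)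

text \<open>The ideal is spanned by homogeneous tensors, each killed by the symmetrizer of its own
  degree. The projection to degree \<open>n\<close> either keeps such a generator or sends it to 0,
  and linearity does the rest.\<close>

lemma nichols_ideal_homogeneous:
  assumes "f \<in> nichols_ideal B c" "n \<ge> 2"
  shows "quantum_symmetrizer c n (homogeneous_part n f) = 0"
  using assms(1) unfolding nichols_ideal_def
proof (induction rule: free_vs.span_induct_alt)
  case base
  then show ?case by (simp add: linmap_zero linmap_homogeneous_part linmap_quantum_symmetrizer)
next
  case (step a p r)
  then have "quantum_symmetrizer c n (homogeneous_part n p) = 0"
    using assms(2) by (auto simp: homogeneous_part_tensor_power linmap_zero linmap_quantum_symmetrizer)
  then show ?case
    using step by (simp add: linmapD[OF linmap_homogeneous_part] linmapD[OF linmap_quantum_symmetrizer])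
qed

text \<open>Finitely many representatives have bounded degree. A tensor of larger degree
  \<open>n\<close> is therefore congruent to a combination without a part of degree
  \<open>n\<close>, and comparing the parts of degree \<open>n\<close> puts it in the kernel of the
  symmetrizer.\<close>

lemma nichols_finite_dim_symmetrizer_vanishes:
  fixes c :: "'b \<Rightarrow> 'b \<Rightarrow> ('b, 'k::field) tensor"
  assumes "nichols_finite_dim B c"
  shows "\<exists>N. \<forall>n\<ge>N. \<forall>f\<in>tensor_power B n. quantum_symmetrizer c n f = 0"
proof -
  obtain S where S: "finite S" "S \<subseteq> tensor_algebra B"
    and span: "\<And>X. X \<in> nichols_algebra B c \<Longrightarrow> \<exists>f\<in>free_vs.span S. f \<in> X"
    using assms by (auto simp: nichols_finite_dim_def)
  define W where "W = (\<Union>s\<in>S. Poly_Mapping.keys s)"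
  have "finite W" using S by (auto simp: W_def)
  \<comment> \<open>Larger than every length in the supports; \<open>insert 0\<close> covers empty
    \<open>W\<close>, and the two \<open>Suc\<close> also give \<open>N \<ge> 2\<close>, where the
    relations of the ideal start.\<close>
  define N where "N = Suc (Suc (Max (insert 0 (length ` W))))"
  have N: "length w < N" if "w \<in> W" for w
    using \<open>finite W\<close> that by (auto simp: N_def less_Suc_eq_le intro!: le_SucI)
  have part: "homogeneous_part n h = 0" if "h \<in> free_vs.span S" "n \<ge> N" for h n
    using that(1)
  proof (induction rule: free_vs.span_induct_alt)
    case base
    then show ?case by (simp add: linmap_zero linmap_homogeneous_part)
  next
    case (step a p r)
    have "homogeneous_part n p = 0"
    proof (rule poly_mapping_eqI)
      fix w
      have "Poly_Mapping.lookup p w = 0" if "length w = n"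
        using N[of w] \<open>n \<ge> N\<close> that step(1) by (force simp: W_def in_keys_iff)
      then show "Poly_Mapping.lookup (homogeneous_part n p) w = Poly_Mapping.lookup 0 w"
        by (simp add: lookup_homogeneous_part)
    qed
    with step show ?case by (simp add: linmapD[OF linmap_homogeneous_part])
  qed
  have "quantum_symmetrizer c n f = 0" if n: "n \<ge> N" and f: "f \<in> tensor_power B n" for n f
  proof -
    let ?R = "{(f, h). f \<in> tensor_algebra B \<and> h \<in> tensor_algebra B \<and> f - h \<in> nichols_ideal B c}"
    have "f \<in> tensor_algebra B"
      using f by (auto simp: tensor_algebra_def tensor_power_def)
    then have "?R `` {f} \<in> nichols_algebra B c"
      unfolding nichols_algebra_def by (rule quotientI)
    then obtain h where h: "h \<in> free_vs.span S" "h \<in> ?R `` {f}"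
      using span by blast
    then have "f - h \<in> nichols_ideal B c" by auto
    moreover have "n \<ge> 2" using n by (simp add: N_def)
    ultimately have "quantum_symmetrizer c n (homogeneous_part n (f - h)) = 0"
      by (rule nichols_ideal_homogeneous)
    moreover have "homogeneous_part n (f - h) = f"
      using part[OF h(1) n] f
      by (simp add: linmap_diff[OF linmap_homogeneous_part] homogeneous_part_tensor_power[OF f])
    ultimately show ?thesis by simp
  qed
  then show ?thesis by blast
qed

section \<open>Inversions and reduced expressions\<close>

abbreviation adjacent :: "nat \<Rightarrow> nat \<Rightarrow> nat" where
  "adjacent i \<equiv> Transposition.transpose i (Suc i)"

abbreviation perm_inv :: "(nat \<Rightarrow> nat) \<Rightarrow> nat \<Rightarrow> nat" where
  "perm_inv \<equiv> inv_into UNIV"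

definition inversion_set :: "(nat \<Rightarrow> nat) \<Rightarrow> (nat \<times> nat) set" where
  "inversion_set \<sigma> = {(a, b). a < b \<and> \<sigma> b < \<sigma> a}"

text \<open>From \<open>n\<close> on the permutation is the identity, while smaller positions keep
  values below \<open>n\<close>, so no inversion reaches beyond \<open>{..<n}\<close>.\<close>

lemma inversion_set_subset:
  assumes "\<sigma> permutes {..<n}"
  shows "inversion_set \<sigma> \<subseteq> {..<n} \<times> {..<n}"
proof -
  have "b < n" if "a < b" "\<sigma> b < \<sigma> a" for a b
  proof (rule ccontr)
    assume "\<not> b < n"
    moreover have "\<sigma> a < n \<longleftrightarrow> a < n"
      using permutes_in_image[OF assms, of a] by simp
    ultimately show False
      using that permutes_not_in[OF assms, of b] permutes_not_in[OF assms, of a] by auto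
  qed
  then show ?thesis by (force simp: inversion_set_def)
qed

lemma finite_inversion_set: "\<sigma> permutes {..<n} \<Longrightarrow> finite (inversion_set \<sigma>)"
  by (rule finite_subset[OF inversion_set_subset]) auto

lemma transpose_less_iff:
  assumes "x \<noteq> y" "\<not> ({x, y} = {i, Suc i})"
  shows "adjacent i x < adjacent i y \<longleftrightarrow> x < y"
  using assms by (auto simp: Transposition.transpose_def)

text \<open>Composing with \<open>adjacent i\<close> on the left exchanges the values
  \<open>i\<close> and \<open>Suc i\<close>; only the pair of positions carrying these two values
  changes its order.\<close>

lemma inversion_set_ascent:
  assumes "bij \<sigma>" "perm_inv \<sigma> i < perm_inv \<sigma> (Suc i)"
  shows "inversion_set (adjacent i \<circ> \<sigma>) = insert (perm_inv \<sigma> i, perm_inv \<sigma> (Suc i)) (inversion_set \<sigma>)"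
    and "(perm_inv \<sigma> i, perm_inv \<sigma> (Suc i)) \<notin> inversion_set \<sigma>"
proof -
  have s: "\<sigma> (perm_inv \<sigma> j) = j" for j using assms(1) by (simp add: bij_is_surj surj_f_inv_f)
  show "(perm_inv \<sigma> i, perm_inv \<sigma> (Suc i)) \<notin> inversion_set \<sigma>" by (simp add: inversion_set_def s)
  have "(a, b) \<in> inversion_set (adjacent i \<circ> \<sigma>) \<longleftrightarrow>
      (a, b) \<in> insert (perm_inv \<sigma> i, perm_inv \<sigma> (Suc i)) (inversion_set \<sigma>)" for a b
  proof (cases "{\<sigma> b, \<sigma> a} = {i, Suc i}")
    case True
    then consider "a = perm_inv \<sigma> i" "b = perm_inv \<sigma> (Suc i)" | "b = perm_inv \<sigma> i" "a = perm_inv \<sigma> (Suc i)"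
      by (metis assms(1) bij_inv_eq_iff doubleton_eq_iff)
    then show ?thesis using assms(2) by cases (auto simp: inversion_set_def s)
  next
    case False
    have "\<not> (a = perm_inv \<sigma> i \<and> b = perm_inv \<sigma> (Suc i))" using False s by auto
    moreover have "\<sigma> a \<noteq> \<sigma> b" if "a < b" using assms(1) that by (metis bij_pointE less_irrefl)
    ultimately show ?thesis
      using False transpose_less_iff[of "\<sigma> b" "\<sigma> a" i] by (auto simp: inversion_set_def)
  qed
  then show "inversion_set (adjacent i \<circ> \<sigma>) = insert (perm_inv \<sigma> i, perm_inv \<sigma> (Suc i)) (inversion_set \<sigma>)"
    by auto
qed

lemma inv_adjacent_comp:
  assumes "bij \<sigma>"
  shows "perm_inv (adjacent i \<circ> \<sigma>) j = perm_inv \<sigma> (adjacent i j)"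
  by (simp add: o_inv_distrib assms)

text \<open>A descent of \<open>\<sigma>\<close> is an ascent of
  \<open>adjacent i \<circ> \<sigma>\<close>, and composing once more with \<open>adjacent i\<close>
  returns \<open>\<sigma>\<close>.\<close>

lemma card_inversion_set_descent:
  assumes "\<sigma> permutes {..<n}" "perm_inv \<sigma> (Suc i) < perm_inv \<sigma> i"
  shows "card (inversion_set \<sigma>) = Suc (card (inversion_set (adjacent i \<circ> \<sigma>)))"
proof -
  have b: "bij \<sigma>" using assms permutes_bij by blast
  define \<tau> where "\<tau> = adjacent i \<circ> \<sigma>"
  have "bij \<tau>" unfolding \<tau>_def using b by (intro bij_comp) auto
  moreover have "perm_inv \<tau> i < perm_inv \<tau> (Suc i)"
    using assms(2) b by (simp add: \<tau>_def inv_adjacent_comp del: o_apply)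
  ultimately have "inversion_set (adjacent i \<circ> \<tau>) = insert (perm_inv \<tau> i, perm_inv \<tau> (Suc i)) (inversion_set \<tau>)"
    "(perm_inv \<tau> i, perm_inv \<tau> (Suc i)) \<notin> inversion_set \<tau>"
    by (rule inversion_set_ascent)+
  moreover have "adjacent i \<circ> \<tau> = \<sigma>" by (simp add: \<tau>_def fun_eq_iff)
  moreover have "finite (inversion_set \<tau>)"
    using calculation finite_inversion_set[OF assms(1)] by (metis finite_insert)
  ultimately show ?thesis using \<tau>_def by auto
qed

section \<open>Length of an expression versus number of inversions\<close>

lemma transposition_prod_Nil [simp]: "transposition_prod [] = id"
  and transposition_prod_Cons [simp]: "transposition_prod (i # is) = adjacent i \<circ> transposition_prod is"
  by (simp_all add: transposition_prod_def)

lemma transposition_prod_permutes: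
  "set is \<subseteq> {i. Suc i < n} \<Longrightarrow> transposition_prod is permutes {..<n}"
  by (induction "is") (auto intro!: permutes_compose permutes_swap_id simp: permutes_id[unfolded id_def])

lemma card_inversion_set_adjacent:
  assumes "\<sigma> permutes {..<n}"
  shows "card (inversion_set (adjacent i \<circ> \<sigma>)) =
    (if perm_inv \<sigma> i < perm_inv \<sigma> (Suc i) then Suc (card (inversion_set \<sigma>)) else card (inversion_set \<sigma>) - 1)"
proof -
  have b: "bij \<sigma>" using assms permutes_bij by blast
  have "perm_inv \<sigma> i \<noteq> perm_inv \<sigma> (Suc i)" using b by (metis bij_inv_eq_iff n_not_Suc_n)
  then show ?thesis
    using inversion_set_ascent[OF b] finite_inversion_set[OF assms]
      card_inversion_set_descent[OF assms, of i] by (auto simp del: o_apply)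
qed

text \<open>Each further adjacent transposition raises the number of inversions by at most
  one.\<close>

lemma card_inversion_set_le_length:
  assumes "set is \<subseteq> {i. Suc i < n}"
  shows "card (inversion_set (transposition_prod is)) \<le> length is"
  using assms
proof (induction "is")
  case Nil
  have "inversion_set id = {}" by (auto simp: inversion_set_def)
  then show ?case by (simp add: id_def)
next
  case (Cons i "is")
  then show ?case
    using card_inversion_set_adjacent[OF transposition_prod_permutes[of "is" n], of i]
    by (auto simp del: o_apply)
qed

text \<open>Sorting by adjacent swaps: a descent allows one transposition to be split off, at the
  cost of exactly one inversion. Without descents the permutation is the identity.\<close>

lemma exists_expr_length_inversions:
  assumes "\<sigma> permutes {..<n}"
  shows "\<exists>is. set is \<subseteq> {i. Suc i < n} \<and> transposition_prod is = \<sigma> \<and> length is = card (inversion_set \<sigma>)"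
  using assms
proof (induction "card (inversion_set \<sigma>)" arbitrary: \<sigma> rule: less_induct)
  case less
  have b: "bij \<sigma>" using less permutes_bij by blast
  show ?case
  proof (cases "\<exists>i. Suc i < n \<and> perm_inv \<sigma> (Suc i) < perm_inv \<sigma> i")
    case True
    then obtain i where i: "Suc i < n" "perm_inv \<sigma> (Suc i) < perm_inv \<sigma> i" by blast
    have card: "card (inversion_set \<sigma>) = Suc (card (inversion_set (adjacent i \<circ> \<sigma>)))"
      using less.prems i(2) by (rule card_inversion_set_descent)
    have "adjacent i \<circ> \<sigma> permutes {..<n}"
      using less.prems i by (intro permutes_compose permutes_swap_id) auto
    then obtain "is" where "is": "set is \<subseteq> {i. Suc i < n}" "transposition_prod is = adjacent i \<circ> \<sigma>"
      "length is = card (inversion_set (adjacent i \<circ> \<sigma>))"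
      using less.hyps[of "adjacent i \<circ> \<sigma>"] card by auto
    then show ?thesis using i card
      by (intro exI[of _ "i # is"]) (auto simp: fun_eq_iff)
  next
    case False
    have ninv: "perm_inv \<sigma> permutes {..<n}" using less.prems by (rule permutes_inv)
    have asc: "perm_inv \<sigma> i < perm_inv \<sigma> (Suc i)" if "Suc i < n" for i
      using False that b by (metis bij_inv_eq_iff linorder_neqE_nat n_not_Suc_n)
    \<comment> \<open>The inverse is now strictly increasing on \<open>{..<n}\<close>, so it never
      lies below the identity; a permutation of naturals with this property is the identity.\<close>
    have "i < n \<Longrightarrow> i \<le> perm_inv \<sigma> i" for i
    proof (induction i)
      case (Suc i)
      then show ?case using asc[of i] by linarith
    qed simp
    then have "perm_inv \<sigma> = id" using permutes_natset_ge[OF ninv] by auto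
    then have "\<sigma> = id" using b by (metis inv_inv_eq inv_id)
    moreover have "inversion_set id = {}" by (auto simp: inversion_set_def)
    ultimately show ?thesis by (intro exI[of _ "[]"]) auto
  qed
qed

text \<open>The preceding lemmas bound the minimum from both sides. Only these three facts about the
  chosen expression are used later, so the choice made by \<open>ARG_MIN\<close> does not
  matter.\<close>

lemma reduced_expr:
  assumes "\<sigma> permutes {..<n}"
  shows "set (reduced_expr n \<sigma>) \<subseteq> {i. Suc i < n}" "transposition_prod (reduced_expr n \<sigma>) = \<sigma>"
    "length (reduced_expr n \<sigma>) = card (inversion_set \<sigma>)"
proof -
  obtain js where js: "set js \<subseteq> {i. Suc i < n} \<and> transposition_prod js = \<sigma>"
    "length js = card (inversion_set \<sigma>)" using exists_expr_length_inversions[OF assms] by blast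
  have "(set (reduced_expr n \<sigma>) \<subseteq> {i. Suc i < n} \<and> transposition_prod (reduced_expr n \<sigma>) = \<sigma>)
     \<and> length (reduced_expr n \<sigma>) \<le> length js"
    unfolding reduced_expr_def by (rule conjI[OF arg_min_natI arg_min_nat_le]) (rule js(1))+
  then show "set (reduced_expr n \<sigma>) \<subseteq> {i. Suc i < n}" "transposition_prod (reduced_expr n \<sigma>) = \<sigma>"
    "length (reduced_expr n \<sigma>) = card (inversion_set \<sigma>)"
    using card_inversion_set_le_length[of "reduced_expr n \<sigma>" n] js(2) by auto
qed

section \<open>Quantum symmetrizers of diagonal type\<close>

text \<open>Pairs are recorded by entries, smaller entry first, for a larger entry standing before a
  smaller one. Recursion on the head matches the splitting of a permutation by its first
  entry.\<close>

fun list_inversions :: "nat list \<Rightarrow> (nat \<times> nat) set" where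
  "list_inversions [] = {}"
| "list_inversions (i # \<tau>) = {(j, i) | j. j \<in> set \<tau> \<and> j < i} \<union> list_inversions \<tau>"

lemma list_inversions_iff:
  "(a, b) \<in> list_inversions \<tau> \<longleftrightarrow> a < b \<and> (\<exists>p r. p < r \<and> r < length \<tau> \<and> \<tau> ! p = b \<and> \<tau> ! r = a)"
proof (induction \<tau>)
  case (Cons i \<tau>)
  have "(\<exists>p r. p < r \<and> r < length (i # \<tau>) \<and> (i # \<tau>) ! p = b \<and> (i # \<tau>) ! r = a) \<longleftrightarrow>
    (b = i \<and> a \<in> set \<tau>) \<or> (\<exists>p r. p < r \<and> r < length \<tau> \<and> \<tau> ! p = b \<and> \<tau> ! r = a)" (is "?L \<longleftrightarrow> ?A \<or> ?B")
  proof
    assume ?L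
    then obtain p r where pr: "p < r" "r < length (i # \<tau>)" "(i # \<tau>) ! p = b" "(i # \<tau>) ! r = a"
      by blast
    then obtain r' where "r = Suc r'" by (cases r) auto
    with pr show "?A \<or> ?B" by (cases p) auto
  next
    assume "?A \<or> ?B"
    then show ?L
    proof
      assume ?A
      then obtain r where "r < length \<tau>" "\<tau> ! r = a" by (auto simp: in_set_conv_nth)
      with \<open>?A\<close> show ?L by (intro exI[of _ 0] exI[of _ "Suc r"]) auto
    next
      assume ?B
      then obtain p r where "p < r" "r < length \<tau>" "\<tau> ! p = b" "\<tau> ! r = a" by blast
      then show ?L by (intro exI[of _ "Suc p"] exI[of _ "Suc r"]) auto
    qed
  qed
  with Cons show ?case by auto
qed simp

lemma finite_list_inversions: "finite (list_inversions \<tau>)"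
proof (induction \<tau>)
  case (Cons i \<tau>)
  have "{(j, i) | j. j \<in> set \<tau> \<and> j < i} \<subseteq> set \<tau> \<times> {i}" by auto
  with Cons show ?case by (auto intro: finite_subset)
qed simp

text \<open>The list is the one-line notation of the inverse: its entries are positions for
  \<open>\<sigma>\<close>, and the index of an entry is its value under
  \<open>\<sigma>\<close>.\<close>

lemma list_inversions_perm:
  assumes "\<sigma> permutes {..<n}"
  shows "list_inversions (map (perm_inv \<sigma>) [0..<n]) = inversion_set \<sigma>"
proof -
  have b: "bij \<sigma>" using assms permutes_bij by blast
  have "(a, b) \<in> list_inversions (map (perm_inv \<sigma>) [0..<n]) \<longleftrightarrow> (a, b) \<in> inversion_set \<sigma>" for a b
  proof
    assume "(a, b) \<in> list_inversions (map (perm_inv \<sigma>) [0..<n])"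
    then show "(a, b) \<in> inversion_set \<sigma>"
      using bij_is_surj[OF b] by (auto simp: list_inversions_iff inversion_set_def surj_f_inv_f)
  next
    assume ab: "(a, b) \<in> inversion_set \<sigma>"
    then have "a < n" "b < n" using inversion_set_subset[OF assms] by auto
    then have "\<sigma> a < n" "\<sigma> b < n" using permutes_in_image[OF assms] by auto
    then have "\<sigma> b < \<sigma> a \<and> \<sigma> a < length (map (perm_inv \<sigma>) [0..<n]) \<and>
        map (perm_inv \<sigma>) [0..<n] ! \<sigma> b = b \<and> map (perm_inv \<sigma>) [0..<n] ! \<sigma> a = a"
      using ab bij_is_inj[OF b] by (simp add: inversion_set_def)
    moreover have "a < b" using ab by (simp add: inversion_set_def)
    ultimately show "(a, b) \<in> list_inversions (map (perm_inv \<sigma>) [0..<n])"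
      unfolding list_inversions_iff by blast
  qed
  then show ?thesis by auto
qed

text \<open>This turns the sum over permutations in the quantum symmetrizer into a sum over lists,
  which can be computed recursively.\<close>

lemma bij_betw_permutations_lists:
  "bij_betw (\<lambda>\<sigma>. map (perm_inv \<sigma>) [0..<n]) {\<sigma>. \<sigma> permutes {..<n}} (permutations_of_set {..<n})"
  unfolding bij_betw_def
proof
  show "inj_on (\<lambda>\<sigma>. map (perm_inv \<sigma>) [0..<n]) {\<sigma>. \<sigma> permutes {..<n}}"
  proof (rule inj_onI)
    fix \<sigma> \<tau> :: "nat \<Rightarrow> nat"
    assume p: "\<sigma> \<in> {\<sigma>. \<sigma> permutes {..<n}}" "\<tau> \<in> {\<sigma>. \<sigma> permutes {..<n}}"
      and eq: "map (perm_inv \<sigma>) [0..<n] = map (perm_inv \<tau>) [0..<n]"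
    then have "perm_inv \<sigma> permutes {..<n}" "perm_inv \<tau> permutes {..<n}"
      by (auto intro: permutes_inv)
    then have "perm_inv \<sigma> i = perm_inv \<tau> i" for i
      using eq by (cases "i < n") (auto simp: permutes_not_in)
    then have "perm_inv \<sigma> = perm_inv \<tau>" by blast
    then show "\<sigma> = \<tau>"
      using p by (metis mem_Collect_eq permutes_bij inv_inv_eq)
  qed
  show "(\<lambda>\<sigma>. map (perm_inv \<sigma>) [0..<n]) ` {\<sigma>. \<sigma> permutes {..<n}} = permutations_of_set {..<n}"
  proof (intro equalityI subsetI)
    fix xs assume "xs \<in> (\<lambda>\<sigma>. map (perm_inv \<sigma>) [0..<n]) ` {\<sigma>. \<sigma> permutes {..<n}}"
    then obtain \<sigma> where xs: "xs = map (perm_inv \<sigma>) [0..<n]" "\<sigma> permutes {..<n}" by blast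
    then have p: "perm_inv \<sigma> permutes {..<n}" by (auto intro: permutes_inv)
    have "set xs = {..<n}" using permutes_image[OF p] by (simp add: xs(1) atLeast0LessThan)
    moreover have "distinct xs"
      using permutes_inj_on[OF p] by (simp add: xs(1) distinct_map)
    ultimately show "xs \<in> permutations_of_set {..<n}" by (rule permutations_of_setI)
  next
    fix xs assume "xs \<in> permutations_of_set {..<n}"
    then have xs: "set xs = {..<n}" "distinct xs" by (auto dest: permutations_of_setD)
    then have len: "length xs = n" by (metis card_lessThan distinct_card)
    define p where "p i = (if i < n then xs ! i else i)" for i
    have "bij_betw p {..<n} {..<n}"
    proof (rule bij_betw_cong[THEN iffD1])
      show "bij_betw ((!) xs) {..<n} {..<n}"
        by (rule bij_betw_nth) (auto simp: xs len)
    qed (simp add: p_def)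
    then have p: "p permutes {..<n}" by (rule bij_imp_permutes) (simp add: p_def)
    have "xs = map p [0..<n]" by (auto simp: p_def len intro: nth_equalityI)
    then have "xs = map (perm_inv (perm_inv p)) [0..<n]"
      using permutes_bij[OF p] by (simp add: inv_inv_eq)
    then show "xs \<in> (\<lambda>\<sigma>. map (perm_inv \<sigma>) [0..<n]) ` {\<sigma>. \<sigma> permutes {..<n}}"
      using permutes_inv[OF p] by blast
  qed
qed

lemma diff_eq_Suc_imp_eq: "k - i = Suc m \<Longrightarrow> k = Suc (i + m)" for k i m :: nat
  by simp

text \<open>The inverse appears because \<open>braid_perm\<close> moves the letter at position \<open>i\<close> to position \<open>\<sigma> i\<close>.\<close>

lemma braid_perm_diagonal:
  fixes q :: "'b \<Rightarrow> 'b \<Rightarrow> 'k::field"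
  assumes diag: "\<And>a b. a \<in> D \<Longrightarrow> b \<in> D \<Longrightarrow> c a b = Poly_Mapping.single [b, a] (q a b)"
    and w: "w \<in> lists D" "length w = n" and \<sigma>: "\<sigma> permutes {..<n}"
  shows "braid_perm c n \<sigma> (Poly_Mapping.single w 1) =
    Poly_Mapping.single (map (\<lambda>k. w ! perm_inv \<sigma> k) [0..<n])
      (\<Prod>(a, b)\<in>inversion_set \<sigma>. q (w ! a) (w ! b))"
proof -
  \<comment> \<open>Generalized to every expression whose length equals its number of inversions, a
    property inherited by the tail of the list.\<close>
  have "foldr (\<lambda>i F. braid c i \<circ> F) is id (Poly_Mapping.single w 1) =
    Poly_Mapping.single (map (\<lambda>k. w ! perm_inv (transposition_prod is) k) [0..<n])
      (\<Prod>(a, b)\<in>inversion_set (transposition_prod is). q (w ! a) (w ! b))"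
    if "set is \<subseteq> {i. Suc i < n}" "length is = card (inversion_set (transposition_prod is))" for "is"
    using that
  proof (induction "is")
    case Nil
    have "inversion_set id = {}" by (auto simp: inversion_set_def)
    moreover have "map (\<lambda>k. w ! perm_inv id k) [0..<n] = w"
      using w(2) map_nth[of w] by simp
    ultimately show ?case by (simp add: id_def)
  next
    case (Cons i "is")
    define \<tau> where "\<tau> = transposition_prod is"
    have sub: "set is \<subseteq> {i. Suc i < n}" and i: "Suc i < n" using Cons.prems by auto
    have \<tau>: "\<tau> permutes {..<n}" unfolding \<tau>_def by (rule transposition_prod_permutes[OF sub])
    then have bij: "bij \<tau>" by (rule permutes_bij)
    have le: "card (inversion_set \<tau>) \<le> length is"
      unfolding \<tau>_def by (rule card_inversion_set_le_length[OF sub])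
    have "Suc (length is) = card (inversion_set (adjacent i \<circ> \<tau>))"
      using Cons.prems(2) by (simp add: \<tau>_def del: o_apply)
    \<comment> \<open>The tail has at least as many letters as \<open>\<tau>\<close> has inversions.
      Prepending \<open>i\<close> must hence create an inversion, and the tail is itself of minimal
      length.\<close>
    then have asc: "perm_inv \<tau> i < perm_inv \<tau> (Suc i)" and len: "length is = card (inversion_set \<tau>)"
      using le card_inversion_set_adjacent[OF \<tau>, of i] by (auto split: if_splits)
    define P where "P = (\<Prod>(a, b)\<in>inversion_set \<tau>. q (w ! a) (w ! b))"
    define u where "u = map (\<lambda>k. w ! perm_inv \<tau> k) [0..<n]"
    have IH: "foldr (\<lambda>i F. braid c i \<circ> F) is id (Poly_Mapping.single w 1) = Poly_Mapping.single u P"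
      using Cons.IH[OF sub] len unfolding \<tau>_def P_def u_def by blast
    have "perm_inv \<tau> k < n" if "k < n" for k
      using permutes_in_image[OF permutes_inv[OF \<tau>], of k] that by simp
    then have "w ! perm_inv \<tau> k \<in> D" if "k < n" for k
      using w that by (auto simp: in_lists_conv_set)
    then have uD: "u ! i \<in> D" "u ! Suc i \<in> D" using i by (auto simp: u_def)
    have swap: "take i u @ [u ! Suc i, u ! i] @ drop (i + 2) u =
        map (\<lambda>k. w ! perm_inv (adjacent i \<circ> \<tau>) k) [0..<n]" (is "?l = ?r")
    proof (rule nth_equalityI)
      show "length ?l = length ?r" using i by (simp add: u_def)
      fix k assume "k < length ?l"
      then have k: "k < n" using i by (simp add: u_def)
      consider "k < i" | "k = i" | "k = Suc i" | "k > Suc i" by linarith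
      then have "?l ! k = u ! adjacent i k"
        using i k by cases (auto simp: nth_append u_def Transposition.transpose_def Suc_diff_le
            numeral_2_eq_2 nth_Cons split: nat.splits dest!: diff_eq_Suc_imp_eq)
      also have "\<dots> = ?r ! k"
        using i k by (auto simp: u_def inv_adjacent_comp[OF bij] Transposition.transpose_def simp del: o_apply)
      finally show "?l ! k = ?r ! k" .
    qed
    have "braid c i (Poly_Mapping.single u P) = Poly_Mapping.single ?l (P * q (u ! i) (u ! Suc i))"
      by (simp add: braid_def diag[OF uD])
    \<comment> \<open>The scalar produced by this braiding is the factor of the single inversion
      that \<open>adjacent i\<close> adds.\<close>
    also have "P * q (u ! i) (u ! Suc i) =
        (\<Prod>(a, b)\<in>inversion_set (adjacent i \<circ> \<tau>). q (w ! a) (w ! b))"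
      using i inversion_set_ascent[OF bij asc] finite_inversion_set[OF \<tau>]
      by (simp add: P_def u_def mult.commute del: o_apply)
    finally have "braid c i (foldr (\<lambda>i F. braid c i \<circ> F) is id (Poly_Mapping.single w 1)) =
        Poly_Mapping.single (map (\<lambda>k. w ! perm_inv (adjacent i \<circ> \<tau>) k) [0..<n])
          (\<Prod>(a, b)\<in>inversion_set (adjacent i \<circ> \<tau>). q (w ! a) (w ! b))"
      unfolding IH swap .
    then show ?case by (simp only: transposition_prod_Cons \<tau>_def foldr_Cons o_apply[of "braid c i"] o_apply[of _ "foldr f is" for f])
  qed
  from this[of "reduced_expr n \<sigma>"] show ?thesis
    using reduced_expr[OF \<sigma>] unfolding braid_perm_def by simp
qed

primrec shuffle_coeff :: "('b \<Rightarrow> 'b \<Rightarrow> 'k::field) \<Rightarrow> (nat \<Rightarrow> 'b) \<Rightarrow> nat set \<Rightarrow> 'b list \<Rightarrow> 'k" where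
  "shuffle_coeff q w M [] = (if M = {} then 1 else 0)"
| "shuffle_coeff q w M (a # v) =
    (\<Sum>i | i \<in> M \<and> w i = a. (\<Prod>j | j \<in> M \<and> j < i. q (w j) a) * shuffle_coeff q w (M - {i}) v)"

lemma list_weight_Cons:
  fixes f :: "nat \<Rightarrow> nat \<Rightarrow> 'k::comm_monoid_mult"
  assumes "i \<notin> set \<tau>"
  shows "(\<Prod>(a, b)\<in>list_inversions (i # \<tau>). f a b) =
    (\<Prod>j | j \<in> set \<tau> \<and> j < i. f j i) * (\<Prod>(a, b)\<in>list_inversions \<tau>. f a b)"
proof -
  have "b \<in> set \<tau>" if "(a, b) \<in> list_inversions \<tau>" for a b
    using that by (auto simp: list_inversions_iff)
  then have "{(j, i) | j. j \<in> set \<tau> \<and> j < i} \<inter> list_inversions \<tau> = {}"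
    using assms by auto
  moreover have "{(j, i) | j. j \<in> set \<tau> \<and> j < i} = (\<lambda>j. (j, i)) ` {j. j \<in> set \<tau> \<and> j < i}" by auto
  ultimately show ?thesis
    by (simp add: prod.union_disjoint finite_list_inversions prod.reindex inj_on_def)
qed

text \<open>Permutations are grouped by their first entry \<open>i\<close>; the inversions ending in
  \<open>i\<close> give the factor in the recursion, and the rest is a permutation of
  \<open>M - {i}\<close>.\<close>

lemma sum_permutations_eq_shuffle_coeff:
  assumes "finite M"
  shows "(\<Sum>\<tau> | \<tau> \<in> permutations_of_set M \<and> map w \<tau> = v. \<Prod>(a, b)\<in>list_inversions \<tau>. q (w a) (w b)) =
    shuffle_coeff q w M v"
  using assms
proof (induction v arbitrary: M)
  case Nil
  have "{\<tau>. \<tau> \<in> permutations_of_set M \<and> map w \<tau> = []} = (if M = {} then {[]} else {})"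
    by (auto simp: permutations_of_set_def)
  then show ?case by simp
next
  case (Cons a v)
  let ?W = "\<lambda>\<tau>. \<Prod>(a, b)\<in>list_inversions \<tau>. q (w a) (w b)"
  let ?T = "\<lambda>M v. {\<tau>. \<tau> \<in> permutations_of_set M \<and> map w \<tau> = v}"
  have fin: "finite (?T M v)" for M v by simp
  have "?T M (a # v) = (\<Union>i\<in>{i \<in> M. w i = a}. (#) i ` ?T (M - {i}) v)"
    by (cases "M = {}") (auto simp: permutations_of_set_nonempty)
  then have "(\<Sum>\<tau>\<in>?T M (a # v). ?W \<tau>) = (\<Sum>i\<in>{i \<in> M. w i = a}. \<Sum>\<tau>\<in>(#) i ` ?T (M - {i}) v. ?W \<tau>)"
    using Cons.prems fin by (subst sum.UNION_disjoint[symmetric]) auto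
  also have "\<dots> = (\<Sum>i\<in>{i \<in> M. w i = a}.
      (\<Prod>j | j \<in> M \<and> j < i. q (w j) a) * shuffle_coeff q w (M - {i}) v)"
  proof (rule sum.cong[OF refl])
    fix i assume i: "i \<in> {i \<in> M. w i = a}"
    have "?W (i # \<tau>) = (\<Prod>j | j \<in> M \<and> j < i. q (w j) a) * ?W \<tau>" if "\<tau> \<in> ?T (M - {i}) v" for \<tau>
    proof -
      have s: "set \<tau> = M - {i}" using that by (auto dest: permutations_of_setD)
      then have "{j. j \<in> set \<tau> \<and> j < i} = {j. j \<in> M \<and> j < i}" by auto
      then show ?thesis using s i
        by (subst list_weight_Cons) auto
    qed
    then have "(\<Sum>\<tau>\<in>(#) i ` ?T (M - {i}) v. ?W \<tau>) =
       (\<Prod>j | j \<in> M \<and> j < i. q (w j) a) * (\<Sum>\<tau>\<in>?T (M - {i}) v. ?W \<tau>)"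
      by (simp add: sum.reindex sum_distrib_left del: list_inversions.simps)
    then show "(\<Sum>\<tau>\<in>(#) i ` ?T (M - {i}) v. ?W \<tau>) =
       (\<Prod>j | j \<in> M \<and> j < i. q (w j) a) * shuffle_coeff q w (M - {i}) v"
      using Cons.IH[of "M - {i}"] Cons.prems by simp
  qed
  finally show ?case by simp
qed

text \<open>A permutation sends \<open>w\<close> to a multiple of one word, so it contributes to the
  coefficient of \<open>v\<close> exactly when the list of its inverse reads \<open>v\<close> off
  \<open>w\<close>.\<close>

lemma lookup_quantum_symmetrizer_diagonal:
  fixes q :: "'b \<Rightarrow> 'b \<Rightarrow> 'k::field"
  assumes diag: "\<And>a b. a \<in> D \<Longrightarrow> b \<in> D \<Longrightarrow> c a b = Poly_Mapping.single [b, a] (q a b)"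
    and w: "w \<in> lists D" "length w = n"
  shows "Poly_Mapping.lookup (quantum_symmetrizer c n (Poly_Mapping.single w 1)) v =
    shuffle_coeff q ((!) w) {..<n} v"
proof -
  let ?P = "{\<sigma>. \<sigma> permutes {..<n}}"
  let ?W = "\<lambda>\<tau>. \<Prod>(a, b)\<in>list_inversions \<tau>. q (w ! a) (w ! b)"
  have "Poly_Mapping.lookup (quantum_symmetrizer c n (Poly_Mapping.single w 1)) v =
    (\<Sum>\<sigma>\<in>?P. if map ((!) w) (map (perm_inv \<sigma>) [0..<n]) = v then ?W (map (perm_inv \<sigma>) [0..<n]) else 0)"
    unfolding quantum_symmetrizer_def lookup_sum
    by (rule sum.cong) (auto simp: braid_perm_diagonal[OF diag w] list_inversions_perm lookup_single
        when_def o_def)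
  also have "\<dots> = (\<Sum>\<tau>\<in>permutations_of_set {..<n}. if map ((!) w) \<tau> = v then ?W \<tau> else 0)"
    by (rule sum.reindex_bij_betw[OF bij_betw_permutations_lists])
  also have "\<dots> = (\<Sum>\<tau> | \<tau> \<in> permutations_of_set {..<n} \<and> map ((!) w) \<tau> = v. ?W \<tau>)"
    by (simp add: sum.If_cases Int_def)
  finally show ?thesis by (simp add: sum_permutations_eq_shuffle_coeff)
qed

section \<open>Skew derivations\<close>

definition prepend :: "'b \<Rightarrow> ('b, 'k::field) tensor \<Rightarrow> ('b, 'k) tensor" where
  "prepend b = lin_ext (\<lambda>w. Poly_Mapping.single (b # w) 1)"

text \<open>The twisted Leibniz rule: each occurrence of \<open>a\<close> is deleted in turn,
  weighted by the scalar for braiding it to the front past the letters before it.\<close>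

primrec skew_deriv_word :: "('b \<Rightarrow> 'b \<Rightarrow> 'k::field) \<Rightarrow> 'b \<Rightarrow> 'b list \<Rightarrow> ('b, 'k) tensor" where
  "skew_deriv_word q a [] = 0"
| "skew_deriv_word q a (b # w) = (if b = a then Poly_Mapping.single w 1 else 0) +
     fscale (q b a) (prepend b (skew_deriv_word q a w))"

definition skew_deriv :: "('b \<Rightarrow> 'b \<Rightarrow> 'k::field) \<Rightarrow> 'b \<Rightarrow> ('b, 'k) tensor \<Rightarrow> ('b, 'k) tensor" where
  "skew_deriv q a = lin_ext (skew_deriv_word q a)"

lemma linmap_prepend: "linmap (prepend b)" and linmap_skew_deriv: "linmap (skew_deriv q a)"
  unfolding prepend_def skew_deriv_def by (rule linmap_lin_ext)+

lemma prepend_single [simp]: "prepend b (Poly_Mapping.single w k) = Poly_Mapping.single (b # w) k"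
  by (simp add: prepend_def)

lemma skew_deriv_single [simp]:
  "skew_deriv q a (Poly_Mapping.single w k) = fscale k (skew_deriv_word q a w)"
  by (simp add: skew_deriv_def)

lemma skew_deriv_prepend:
  "skew_deriv q a (prepend b f) = (if b = a then f else 0) + fscale (q b a) (prepend b (skew_deriv q a f))"
  (is "?L f = ?R f")
proof -
  have "linmap (\<lambda>f. skew_deriv q a (prepend b f))"
    by (rule linmap_comp[OF linmap_skew_deriv linmap_prepend])
  moreover have "linmap (\<lambda>f. (if b = a then f else 0) + fscale (q b a) (prepend b (skew_deriv q a f)))"
    by (rule linmap_add_fun[OF _ linmap_scale_fun[OF linmap_comp[OF linmap_prepend linmap_skew_deriv]]])
      (simp add: linmap_iff)
  moreover have "?L (Poly_Mapping.single w 1) = ?R (Poly_Mapping.single w 1)" for w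
    by (simp only: prepend_single skew_deriv_single free_vs.scale_one skew_deriv_word.simps)
  ultimately show ?thesis by (rule linmap_eqI)
qed

primrec iterated_deriv_coeff :: "('b \<Rightarrow> 'b \<Rightarrow> 'k::field) \<Rightarrow> 'b list \<Rightarrow> ('b, 'k) tensor \<Rightarrow> 'k" where
  "iterated_deriv_coeff q [] f = Poly_Mapping.lookup f []"
| "iterated_deriv_coeff q (a # v) f = iterated_deriv_coeff q v (skew_deriv q a f)"

lemma iterated_deriv_coeff_add:
  "iterated_deriv_coeff q v (f + h) = iterated_deriv_coeff q v f + iterated_deriv_coeff q v h"
  by (induction v arbitrary: f h) (auto simp: lookup_add linmap_add[OF linmap_skew_deriv])

lemma iterated_deriv_coeff_scale:
  "iterated_deriv_coeff q v (fscale a f) = a * iterated_deriv_coeff q v f"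
  by (induction v arbitrary: f) (auto simp: linmap_scale[OF linmap_skew_deriv])

lemma iterated_deriv_coeff_sum:
  "iterated_deriv_coeff q v (\<Sum>i\<in>A. f i) = (\<Sum>i\<in>A. iterated_deriv_coeff q v (f i))"
proof (induction A rule: infinite_finite_induct)
  case (infinite A)
  then show ?case using iterated_deriv_coeff_scale[of q v 0 0] by simp
next
  case empty
  then show ?case using iterated_deriv_coeff_scale[of q v 0 0] by simp
qed (auto simp: iterated_deriv_coeff_add)

text \<open>Writing a word through a sorted list of positions lets the deletion of a letter become
  the removal of a position, as in \<open>shuffle_coeff\<close>.\<close>

lemma skew_deriv_word_sorted:
  fixes w :: "nat \<Rightarrow> 'b" and q :: "'b \<Rightarrow> 'b \<Rightarrow> 'k::field"
  assumes "sorted L" "distinct L"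
  shows "skew_deriv_word q a (map w L) =
    (\<Sum>i | i \<in> set L \<and> w i = a. fscale (\<Prod>j | j \<in> set L \<and> j < i. q (w j) a)
      (Poly_Mapping.single (map w (remove1 i L)) 1))"
  using assms
proof (induction L)
  case (Cons m L)
  have m: "m < i" if "i \<in> set L" for i
    using Cons.prems that by (auto simp: less_le)
  let ?I = "{i. i \<in> set L \<and> w i = a}"
  let ?t = "\<lambda>L i. fscale (\<Prod>j | j \<in> set L \<and> j < i. q (w j) a) (Poly_Mapping.single (map w (remove1 i L)) (1::'k))"
  \<comment> \<open>The position \<open>m\<close> precedes all others, so it survives the deletion
    of \<open>i\<close> and contributes one factor \<open>q (w m) a\<close>.\<close>
  have step: "?t (m # L) i = fscale (q (w m) a) (prepend (w m) (?t L i))" if "i \<in> ?I" for i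
  proof -
    have "{j. j \<in> set (m # L) \<and> j < i} = insert m {j. j \<in> set L \<and> j < i}" using m that by auto
    moreover have "remove1 i (m # L) = m # remove1 i L" using m that by auto
    moreover have "m \<notin> {j. j \<in> set L \<and> j < i}" using m by blast
    ultimately show ?thesis by (simp add: linmap_scale[OF linmap_prepend] del: set_simps)
  qed
  have "{j. j \<in> set (m # L) \<and> j < m} = {}" using m by (auto dest: less_asym)
  then have "?t (m # L) m = Poly_Mapping.single (map w L) 1"
    by (simp only: prod.empty free_vs.scale_one remove1.simps if_True simp_thms)
  moreover have "(\<Sum>i | i \<in> set (m # L) \<and> w i = a. f i) =
      (if w m = a then f m else 0) + (\<Sum>i\<in>?I. f i)" for f :: "nat \<Rightarrow> ('b, 'k) tensor"
  proof -
    have "{i. i \<in> set (m # L) \<and> w i = a} = (if w m = a then insert m ?I else ?I)" by auto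
    moreover have "m \<notin> set L" using m by blast
    ultimately show ?thesis by simp
  qed
  ultimately have "(\<Sum>i | i \<in> set (m # L) \<and> w i = a. ?t (m # L) i) =
      (if w m = a then Poly_Mapping.single (map w L) 1 else 0) + (\<Sum>i\<in>?I. ?t (m # L) i)"
    by (simp only:)
  also have "(\<Sum>i\<in>?I. ?t (m # L) i) = fscale (q (w m) a) (prepend (w m) (\<Sum>i\<in>?I. ?t L i))"
    unfolding linmap_sum[OF linmap_prepend] free_vs.scale_sum_right
    by (rule sum.cong[OF refl step])
  finally show ?case using Cons by simp
qed simp

text \<open>One derivation per letter of \<open>v\<close> follows the recursion of
  \<open>shuffle_coeff\<close>: deleting position \<open>i\<close> leaves the word of
  \<open>M - {i}\<close>.\<close>

lemma iterated_deriv_coeff_eq_shuffle_coeff: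
  assumes "finite M"
  shows "iterated_deriv_coeff q v (Poly_Mapping.single (map w (sorted_list_of_set M)) 1) = shuffle_coeff q w M v"
  using assms
proof (induction v arbitrary: M)
  case Nil
  then show ?case by (auto simp: lookup_single when_def)
next
  case (Cons a v)
  then show ?case
    by (simp add: skew_deriv_word_sorted iterated_deriv_coeff_sum iterated_deriv_coeff_scale
       sorted_list_of_set_remove[symmetric] del: fscale_single)
qed

text \<open>A nonzero iterated derivative thus certifies that \<open>f\<close> is outside the kernel
  of the symmetrizer, with no permutations left to handle. The braiding has to be diagonal only on
  the letters in \<open>D\<close>.\<close>

lemma lookup_quantum_symmetrizer_deriv:
  fixes q :: "'b \<Rightarrow> 'b \<Rightarrow> 'k::field"
  assumes diag: "\<And>a b. a \<in> D \<Longrightarrow> b \<in> D \<Longrightarrow> c a b = Poly_Mapping.single [b, a] (q a b)"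
    and f: "f \<in> tensor_power D n"
  shows "Poly_Mapping.lookup (quantum_symmetrizer c n f) v = iterated_deriv_coeff q v f"
proof -
  have word: "Poly_Mapping.lookup (quantum_symmetrizer c n (Poly_Mapping.single w 1)) v =
      iterated_deriv_coeff q v (Poly_Mapping.single w 1)" if "w \<in> Poly_Mapping.keys f" for w
  proof -
    have w: "w \<in> lists D" "length w = n" using f that by (auto simp: tensor_power_def)
    have "map ((!) w) (sorted_list_of_set {..<n}) = w"
      using map_nth[of w] w(2) by (simp add: lessThan_atLeast0)
    then show ?thesis
      using iterated_deriv_coeff_eq_shuffle_coeff[of "{..<n}" q v "(!) w"]
        lookup_quantum_symmetrizer_diagonal[where D = D and c = c and q = q, OF diag w]
      by simp
  qed
  let ?s = "\<Sum>w\<in>Poly_Mapping.keys f. fscale (Poly_Mapping.lookup f w) (Poly_Mapping.single w 1)"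
  have "Poly_Mapping.lookup (quantum_symmetrizer c n ?s) v = iterated_deriv_coeff q v ?s"
    unfolding linmap_sum[OF linmap_quantum_symmetrizer] linmap_scale[OF linmap_quantum_symmetrizer]
      iterated_deriv_coeff_sum iterated_deriv_coeff_scale lookup_sum lookup_fscale
    using word by (intro sum.cong) auto
  then show ?thesis using poly_mapping_eq_sum_singles[of f] by simp
qed

section \<open>Powers of the braided commutator of two letters\<close>

definition braided_commutator ::
  "('b \<Rightarrow> 'b \<Rightarrow> 'k::field) \<Rightarrow> 'b \<Rightarrow> 'b \<Rightarrow> ('b, 'k) tensor \<Rightarrow> ('b, 'k) tensor" where
  "braided_commutator q x y f = prepend x (prepend y f) - fscale (q x y) (prepend y (prepend x f))"

text \<open>For \<open>y\<close>, the terms \<open>q x y\<close> times \<open>x f\<close> from the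
  two products cancel. For \<open>x\<close>, the two terms in \<open>y f\<close> have coefficients
  \<open>1\<close> and \<open>- q x y * q y x\<close>.\<close>

lemma skew_deriv_braided_commutator:
  assumes "x \<noteq> y"
  shows "skew_deriv q y (braided_commutator q x y f) =
      fscale (q x y * q y y) (braided_commutator q x y (skew_deriv q y f))"
    and "skew_deriv q x (braided_commutator q x y f) =
      fscale (1 - q x y * q y x) (prepend y f) +
      fscale (q x x * q y x) (braided_commutator q x y (skew_deriv q x f))"
  using assms
  by (auto simp: braided_commutator_def linmap_diff[OF linmap_skew_deriv] skew_deriv_prepend
    linmapD[OF linmap_prepend] linmapD[OF linmap_skew_deriv] linmap_zero[OF linmap_prepend] algebra_simps
     free_vs.scale_right_diff_distrib free_vs.scale_right_distrib free_vs.scale_left_diff_distrib)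

lemma linmap_braided_commutator: "linmap (braided_commutator q x y)"
  by (simp add: linmap_iff braided_commutator_def linmapD[OF linmap_prepend] algebra_simps
     free_vs.scale_right_diff_distrib)

text \<open>The element \<open>u^n\<close>, obtained by iterating left multiplication by the
  commutator \<open>u\<close> on the empty word.\<close>

definition commutator_power ::
  "('b \<Rightarrow> 'b \<Rightarrow> 'k::field) \<Rightarrow> 'b \<Rightarrow> 'b \<Rightarrow> nat \<Rightarrow> ('b, 'k) tensor" where
  "commutator_power q x y n = (braided_commutator q x y ^^ n) (Poly_Mapping.single [] 1)"

lemma skew_deriv_commutator_power:
  assumes "x \<noteq> y"
  shows "skew_deriv q y (commutator_power q x y n) = 0"
  by (induction n) (auto simp: commutator_power_def skew_deriv_braided_commutator[OF assms]
     linmap_zero[OF linmap_braided_commutator])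

text \<open>The second hypothesis says that \<open>u\<close> has self-braiding 1. All factors of
  \<open>u^(n+1)\<close> then contribute equally, and the ordinary integer \<open>Suc n\<close>
  appears in place of a quantum integer.\<close>

lemma skew_deriv_skew_deriv_commutator_power:
  assumes "x \<noteq> y" and "q x x * q x y * q y x * q y y = 1"
  shows "skew_deriv q y (skew_deriv q x (commutator_power q x y (Suc n))) =
    fscale (of_nat (Suc n) * (1 - q x y * q y x)) (commutator_power q x y n)"
proof (induction n)
  case 0
  then show ?case
    using assms(1) by (simp add: commutator_power_def skew_deriv_braided_commutator[OF assms(1)]
      linmapD[OF linmap_skew_deriv] skew_deriv_prepend linmap_zero[OF linmap_braided_commutator]
      linmap_zero[OF linmap_prepend] linmap_zero[OF linmap_skew_deriv] del: fscale_single prepend_single)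
next
  case (Suc n)
  have u: "commutator_power q x y (Suc m) = braided_commutator q x y (commutator_power q x y m)" for m
    by (simp add: commutator_power_def)
  \<comment> \<open>Deriving \<open>y\<close> times \<open>u^(n+1)\<close> by \<open>y\<close>
    leaves only \<open>u^(n+1)\<close>, because the powers of \<open>u\<close> are killed by that
    derivation.\<close>
  have "skew_deriv q y (skew_deriv q x (commutator_power q x y (Suc (Suc n)))) =
     fscale (1 - q x y * q y x) (commutator_power q x y (Suc n)) +
     fscale (q x x * q y x * (q x y * q y y))
       (braided_commutator q x y (skew_deriv q y (skew_deriv q x (commutator_power q x y (Suc n)))))"
    unfolding u[of "Suc n"] skew_deriv_braided_commutator[OF assms(1)] linmapD[OF linmap_skew_deriv]
    by (simp add: skew_deriv_prepend skew_deriv_commutator_power[OF assms(1)] linmap_zero[OF linmap_prepend])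
  also have "q x x * q y x * (q x y * q y y) = 1" using assms(2) by (simp add: mult_ac)
  finally show ?case unfolding Suc.IH linmap_scale[OF linmap_braided_commutator] u[symmetric]
    unfolding free_vs.scale_one free_vs.scale_left_distrib[symmetric] by (simp add: algebra_simps)
qed

lemma iterated_deriv_coeff_commutator_power:
  assumes "x \<noteq> y" and "q x x * q x y * q y x * q y y = 1"
  shows "iterated_deriv_coeff q (concat (replicate n [x, y])) (commutator_power q x y n) =
    fact n * (1 - q x y * q y x) ^ n"
proof (induction n)
  case 0
  show ?case by (simp add: commutator_power_def)
next
  case (Suc n)
  show ?case
    using Suc by (simp add: skew_deriv_skew_deriv_commutator_power[OF assms] iterated_deriv_coeff_scale mult_ac)
qed

text \<open>With \<open>q x x = 1\<close> the skew derivation acts on powers of \<open>x\<close> as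
  the ordinary derivative.\<close>

lemma iterated_deriv_coeff_power:
  fixes q :: "'b \<Rightarrow> 'b \<Rightarrow> 'k::field_char_0"
  assumes "q x x = 1"
  shows "iterated_deriv_coeff q (replicate n x) (Poly_Mapping.single (replicate n x) 1) = fact n"
proof (induction n)
  case (Suc n)
  have "skew_deriv_word q x (x # replicate m x) =
      fscale (of_nat (Suc m)) (Poly_Mapping.single (replicate m x) (1 :: 'k))" for m
  proof (induction m)
    case (Suc m)
    have "skew_deriv_word q x (x # replicate (Suc m) x) =
      Poly_Mapping.single (x # replicate m x) 1 +
      prepend x (skew_deriv_word q x (x # replicate m x))"
      using assms by simp
    also have "\<dots> = fscale (of_nat (Suc (Suc m))) (Poly_Mapping.single (replicate (Suc m) x) 1)"
      unfolding Suc by (simp add: single_add[symmetric] add.commute)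
    finally show ?case .
  qed (simp add: prepend_def linmap_zero[OF linmap_lin_ext])
  with Suc show ?case by (simp add: iterated_deriv_coeff_scale del: fscale_single skew_deriv_word.simps)
qed simp

section \<open>Obstructions to finite dimension from one or two letters\<close>

lemma single_in_tensor_power: "w \<in> lists B \<Longrightarrow> Poly_Mapping.single w k \<in> tensor_power B (length w)"
  by (auto simp: tensor_power_def)

lemma tensor_power_subspace: "free_vs.subspace (tensor_power B n :: ('b, 'k::field) tensor set)"
  unfolding free_vs.subspace_def
proof (intro conjI ballI allI)
  show "0 \<in> tensor_power B n" by (simp add: tensor_power_def)
next
  fix f h :: "('b, 'k) tensor" assume "f \<in> tensor_power B n" "h \<in> tensor_power B n"
  then show "f + h \<in> tensor_power B n" using keys_add[of f h] unfolding tensor_power_def by blast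
next
  fix a and f :: "('b, 'k) tensor" assume "f \<in> tensor_power B n"
  then show "fscale a f \<in> tensor_power B n" by (auto simp: tensor_power_def in_keys_iff subset_iff)
qed

lemma prepend_in_tensor_power:
  assumes "b \<in> B" "f \<in> tensor_power B n"
  shows "prepend b f \<in> tensor_power B (Suc n)"
  unfolding prepend_def lin_ext_def
proof (intro free_vs.subspace_sum[OF tensor_power_subspace] free_vs.subspace_scale[OF tensor_power_subspace])
  fix w assume "w \<in> Poly_Mapping.keys f"
  then show "Poly_Mapping.single (b # w) 1 \<in> tensor_power B (Suc n)"
    using assms single_in_tensor_power[of "b # w" B 1] by (auto simp: tensor_power_def)
qed

lemma commutator_power_in_tensor_power:
  assumes "x \<in> B" "y \<in> B"
  shows "commutator_power q x y n \<in> tensor_power B (2 * n)"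
proof (induction n)
  case 0
  show ?case using single_in_tensor_power[of "[]" B 1] by (simp add: commutator_power_def)
next
  case (Suc n)
  then have "braided_commutator q x y (commutator_power q x y n) \<in> tensor_power B (Suc (Suc (2 * n)))"
    unfolding braided_commutator_def
    by (intro free_vs.subspace_diff[OF tensor_power_subspace] free_vs.subspace_scale[OF tensor_power_subspace]
      prepend_in_tensor_power assms)
  then show ?case by (simp add: commutator_power_def)
qed

lemma tensor_power_mono: "D \<subseteq> B \<Longrightarrow> tensor_power D n \<subseteq> tensor_power B n"
  by (auto simp: tensor_power_def)

text \<open>Otherwise the symmetrizer of \<open>u^N\<close>, of degree \<open>2 * N\<close>, has a
  coefficient \<open>fact N * (1 - q x y * q y x) ^ N\<close>. It is nonzero in characteristic 0,
  against the vanishing in large degrees.\<close>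

lemma nichols_finite_dim_diagonal_eq_1:
  fixes q :: "'b \<Rightarrow> 'b \<Rightarrow> 'k::field_char_0"
  assumes "nichols_finite_dim B c"
    and "x \<in> B" "y \<in> B" "x \<noteq> y"
    and diag: "\<And>a b. a \<in> {x, y} \<Longrightarrow> b \<in> {x, y} \<Longrightarrow> c a b = Poly_Mapping.single [b, a] (q a b)"
    and "q x x * q x y * q y x * q y y = 1"
  shows "q x y * q y x = 1"
proof (rule ccontr)
  assume ne: "q x y * q y x \<noteq> 1"
  obtain N where N: "\<And>n f. n \<ge> N \<Longrightarrow> f \<in> tensor_power B n \<Longrightarrow> quantum_symmetrizer c n f = 0"
    using nichols_finite_dim_symmetrizer_vanishes[OF assms(1)] by blast
  have mem: "commutator_power q x y N \<in> tensor_power {x, y} (2 * N)"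
    by (rule commutator_power_in_tensor_power) auto
  then have "quantum_symmetrizer c (2 * N) (commutator_power q x y N) = 0"
    using N[of "2 * N"] tensor_power_mono[of "{x, y}" B] assms(2,3) by auto
  then have "fact N * (1 - q x y * q y x) ^ N = 0"
    using lookup_quantum_symmetrizer_deriv[where c = c and q = q and D = "{x, y}", OF diag mem]
      iterated_deriv_coeff_commutator_power[of x y q N] assms by (metis lookup_zero)
  with ne show False by simp
qed

text \<open>If the self-braiding of \<open>x\<close> were 1, the symmetrizer of the word
  \<open>x^N\<close> would have the coefficient \<open>fact N\<close>, nonzero in characteristic 0
  for every \<open>N\<close>.\<close>

lemma nichols_finite_dim_diagonal_neq_1:
  fixes q :: "'b \<Rightarrow> 'b \<Rightarrow> 'k::field_char_0"
  assumes "nichols_finite_dim B c" "x \<in> B" and c: "c x x = Poly_Mapping.single [x, x] (q x x)"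
  shows "q x x \<noteq> 1"
proof
  assume 1: "q x x = 1"
  obtain N where N: "\<And>n f. n \<ge> N \<Longrightarrow> f \<in> tensor_power B n \<Longrightarrow> quantum_symmetrizer c n f = 0"
    using nichols_finite_dim_symmetrizer_vanishes[OF assms(1)] by blast
  have mem: "Poly_Mapping.single (replicate N x) 1 \<in> tensor_power {x} N"
    using single_in_tensor_power[of "replicate N x" "{x}" 1] by (simp add: in_lists_conv_set)
  then have "quantum_symmetrizer c N (Poly_Mapping.single (replicate N x) 1) = 0"
    using N[of N] tensor_power_mono[of "{x}" B] assms(2) by auto
  moreover have "c a b = Poly_Mapping.single [b, a] (q a b)" if "a \<in> {x}" "b \<in> {x}" for a b
    using c that by simp
  ultimately have "(fact N :: 'k) = 0"
    using lookup_quantum_symmetrizer_deriv[of "{x}" c q, OF _ mem]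
      iterated_deriv_coeff_power[of q x N, OF 1] by (metis lookup_zero)
  then show False by simp
qed

section \<open>Real elements of \<open>SL(2, q)\<close>\<close>

lemma finite_field_two_neq_0:
  assumes "odd (CARD('f::finite_field))"
  shows "(2::'f) \<noteq> 0"
proof
  assume "(2::'f) = 0"
  then have "of_nat 2 = (0::'f)" by simp
  then have "CHAR('f) dvd 2" by (simp only: of_nat_eq_0_iff_char_dvd)
  moreover have "CHAR('f) \<noteq> 1" by simp
  ultimately have "CHAR('f) = 2" using two_is_prime_nat by (metis prime_nat_iff)
  then show False using assms CHAR_dvd_CARD[where 'a = 'f] by simp
qed

text \<open>Every value has at most two square roots and 0 has only one, so the field has at most
  \<open>2 * (card Q - 1) + 1\<close> elements.\<close>

lemma card_squares:
  "CARD('f::finite_field) < 2 * card (range (\<lambda>a :: 'f. a ^ 2))"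
proof -
  define Q :: "'f set" where "Q = range (\<lambda>a. a ^ 2)"
  have "card {a :: 'f. a ^ 2 = y} \<le> 2" for y
  proof (cases "\<exists>b. b ^ 2 = y")
    case True
    then obtain b where "b ^ 2 = y" by blast
    then have "{a. a ^ 2 = y} \<subseteq> {b, - b}" by (auto simp: power2_eq_iff)
    then have "card {a. a ^ 2 = y} \<le> card {b, - b}" by (intro card_mono) auto
    also have "\<dots> \<le> 2" by (simp add: card_insert_if)
    finally show ?thesis .
  next
    case False
    then have "{a. a ^ 2 = y} = {}" by auto
    then show ?thesis by simp
  qed
  then have "(\<Sum>y\<in>Q - {0}. card {a :: 'f. a ^ 2 = y}) \<le> (\<Sum>y\<in>Q - {0}. 2)"
    by (intro sum_mono)
  moreover have "card (\<Union>y\<in>Q - {0}. {a :: 'f. a ^ 2 = y}) \<le> (\<Sum>y\<in>Q - {0}. card {a :: 'f. a ^ 2 = y})"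
    by (rule card_UN_le) simp
  moreover have "CARD('f) \<le> Suc (card (\<Union>y\<in>Q - {0}. {a :: 'f. a ^ 2 = y}))"
  proof -
    have "(UNIV :: 'f set) \<subseteq> insert 0 (\<Union>y\<in>Q - {0}. {a. a ^ 2 = y})"
      by (auto simp: Q_def)
    then have "CARD('f) \<le> card (insert 0 (\<Union>y\<in>Q - {0}. {a :: 'f. a ^ 2 = y}))"
      by (intro card_mono) auto
    then show ?thesis by (simp add: card_insert_if split: if_splits)
  qed
  moreover have "0 \<in> Q" unfolding Q_def by (rule image_eqI[of _ _ 0]) auto
  then have "card Q = Suc (card (Q - {0}))" by (metis card.remove finite)
  ultimately show ?thesis unfolding Q_def[symmetric] by simp
qed

text \<open>Pigeonhole: the values \<open>a ^ 2\<close> and the values \<open>s - d * b ^ 2\<close>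
  each fill more than half of the field, hence meet.\<close>

lemma finite_field_binary_form_universal:
  fixes d s :: "'f::finite_field"
  assumes "d \<noteq> 0"
  shows "\<exists>a b. a ^ 2 + d * b ^ 2 = s"
proof -
  define Q :: "'f set" where "Q = range (\<lambda>a. a ^ 2)"
  have "range (\<lambda>b. s - d * b ^ 2) = (\<lambda>y. s - d * y) ` Q" by (auto simp: Q_def)
  moreover have "inj_on (\<lambda>y. s - d * y) Q" using assms by (auto intro: inj_onI)
  ultimately have c: "card (range (\<lambda>b. s - d * b ^ 2)) = card Q"
    by (simp add: card_image)
  have "Q \<inter> range (\<lambda>b. s - d * b ^ 2) \<noteq> {}"
  proof
    assume "Q \<inter> range (\<lambda>b. s - d * b ^ 2) = {}"
    then have "card (Q \<union> range (\<lambda>b. s - d * b ^ 2)) = 2 * card Q"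
      using c by (subst card_Un_disjoint) auto
    moreover have "card (Q \<union> range (\<lambda>b. s - d * b ^ 2)) \<le> CARD('f)"
      by (rule card_mono) auto
    ultimately show False using card_squares[where 'f = 'f] by (simp add: Q_def)
  qed
  then obtain a b where "a ^ 2 = s - d * b ^ 2" by (auto simp: Q_def)
  then have "a ^ 2 + d * b ^ 2 = s" by simp
  then show ?thesis by blast
qed

text \<open>Completing the square. The form is the determinant of \<open>a + b g\<close> for the
  companion matrix \<open>g\<close> of trace \<open>t\<close> and determinant 1.\<close>

lemma finite_field_norm_form_universal:
  fixes t s :: "'f::finite_field"
  assumes "odd (CARD('f))" "t ^ 2 \<noteq> 4"
  shows "\<exists>a b. a ^ 2 + t * a * b + b ^ 2 = s"
proof -
  have 2: "(2::'f) \<noteq> 0" by (rule finite_field_two_neq_0) fact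
  define r where "r = t / 2"
  have t: "t = 2 * r" using 2 by (simp add: r_def)
  define d where "d = 1 - r ^ 2"
  have "4 * d = 4 - t ^ 2" by (simp add: d_def t power_mult_distrib right_diff_distrib)
  then have "d \<noteq> 0" using assms(2) by auto
  then obtain u b where u: "u ^ 2 + d * b ^ 2 = s" using finite_field_binary_form_universal by blast
  have "(u - r * b) ^ 2 + t * (u - r * b) * b + b ^ 2 = s"
    unfolding u[symmetric] d_def t by (simp add: power2_eq_square algebra_simps)
  then show ?thesis by blast
qed

text \<open>Avoids knowing that \<open>q\<close> is a power of the characteristic: the polynomial
  \<open>(1 + X)^q - 1 - X^q\<close> has degree less than \<open>q\<close> and vanishes on \<open>K\<close>.\<close>

lemma one_add_power_card_subfield:
  fixes b :: "'e::idom" and K :: "'e set"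
  assumes "finite K" "card K = q" "\<And>y. y \<in> K \<Longrightarrow> y ^ q = y" "\<And>y. y \<in> K \<Longrightarrow> 1 + y \<in> K"
    and q: "q > 0"
  shows "(1 + b) ^ q = 1 + b ^ q"
proof -
  define P :: "'e poly" where "P = (\<Sum>k\<in>{1..<q}. Polynomial.monom (of_nat (q choose k)) k)"
  have ev: "poly P y = (1 + y) ^ q - 1 - y ^ q" for y
  proof -
    have "(1 + y) ^ q = (\<Sum>k\<le>q. of_nat (q choose k) * y ^ k)"
      using binomial_ring[of y 1 q] by (simp add: add.commute)
    also have "{..q} = insert 0 (insert q {1..<q})" using q by auto
    also have "(\<Sum>k\<in>\<dots>. of_nat (q choose k) * y ^ k) = 1 + (y ^ q + poly P y)"
      using q by (simp add: P_def poly_sum poly_monom)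
    finally show ?thesis by simp
  qed
  have "P = 0"
  proof (rule ccontr)
    assume "P \<noteq> 0"
    have "K \<subseteq> {y. poly P y = 0}" using assms(3,4) by (auto simp: ev)
    then have "q \<le> card {y. poly P y = 0}"
      using assms(2) card_mono[OF poly_roots_finite[OF \<open>P \<noteq> 0\<close>]] by blast
    also have "\<dots> \<le> degree P" by (rule card_poly_roots_bound) fact
    also have "degree P \<le> q - 1"
      unfolding P_def by (rule degree_sum_le) (auto intro: order.trans[OF degree_monom_le])
    finally show False using q by simp
  qed
  with ev[of b] have "(1 + b) ^ q - 1 - b ^ q = 0" by simp
  then show ?thesis by (simp add: diff_eq_eq add.commute)
qed

text \<open>The polynomial \<open>X^q - X\<close> has at most \<open>q\<close> roots, and
  \<open>K\<close> already supplies \<open>q\<close> of them.\<close>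

lemma power_card_fixed_in_subfield:
  fixes y :: "'e::idom"
  assumes "finite K" "card K = q" "\<And>y. y \<in> K \<Longrightarrow> y ^ q = y" "q > 1" "y ^ q = y"
  shows "y \<in> K"
proof -
  define P :: "'e poly" where "P = Polynomial.monom 1 q - Polynomial.monom 1 1"
  have ev: "poly P z = z ^ q - z" for z by (simp add: P_def poly_monom)
  have "Polynomial.coeff P q = 1" using assms(4) by (simp add: P_def)
  then have "P \<noteq> 0" by auto
  have "K \<subseteq> {y. poly P y = 0}" using assms(3) by (auto simp: ev)
  moreover have "card {y. poly P y = 0} \<le> card K"
  proof -
    have "card {y. poly P y = 0} \<le> degree P" by (rule card_poly_roots_bound) fact
    also have "\<dots> \<le> q" unfolding P_def using assms(4)
      by (intro degree_diff_le order.trans[OF degree_monom_le]) auto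
    finally show ?thesis using assms(2) by simp
  qed
  ultimately have "K = {y. poly P y = 0}"
    by (rule card_seteq[OF poly_roots_finite[OF \<open>P \<noteq> 0\<close>]])
  then show ?thesis using assms(5) by (simp add: ev)
qed

text \<open>The trace is fixed by the \<open>q\<close>-th power map, hence lies in the range of
  \<open>\<iota>\<close>, where \<open>the_inv\<close> is meaningful. As the norm is 1, a trace with
  square 4 would give \<open>(x - x ^ q) ^ 2 = 0\<close>, putting \<open>x\<close> in the
  subfield.\<close>

lemma norm_one_trace:
  fixes \<iota> :: "'f::finite_field \<Rightarrow> 'e::finite_field" and q :: nat and x :: 'e
  assumes F: "CARD('f) = q" and E: "CARD('e) = q ^ 2"
    and hom: "\<iota> 1 = 1" "\<And>a b. \<iota> (a + b) = \<iota> a + \<iota> b" "\<And>a b. \<iota> (a * b) = \<iota> a * \<iota> b"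
    and x: "x \<notin> range \<iota>" "x * x ^ q = 1"
  shows "(the_inv \<iota> (x + x ^ q)) ^ 2 \<noteq> 4"
proof -
  have ne: "\<iota> a \<noteq> 0" if "a \<noteq> 0" for a using hom(3)[of a "inverse a"] that hom(1) by auto
  have inj: "inj \<iota>"
  proof (rule injI)
    fix a b assume "\<iota> a = \<iota> b"
    then have "\<iota> (a - b) = 0" using hom(2)[of "a - b" b] by simp
    then show "a = b" using ne[of "a - b"] by auto
  qed
  have pow: "\<iota> (a ^ n) = \<iota> a ^ n" for a n by (induction n) (auto simp: hom)
  define K where "K = range \<iota>"
  have q1: "q > 1"
  proof -
    have "card {0, 1 :: 'f} \<le> CARD('f)" by (rule card_mono) auto
    then show ?thesis using F by simp
  qed
  have K: "finite K" "card K = q" "\<And>y. y \<in> K \<Longrightarrow> y ^ q = y" "\<And>y. y \<in> K \<Longrightarrow> 1 + y \<in> K"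
  proof -
    show "finite K" "card K = q" using inj F by (auto simp: K_def card_image)
    show "y ^ q = y" if "y \<in> K" for y
      using that pow[of _ q] finite_field_power_card_eq_same[where 'a = 'f] F by (auto simp: K_def)
    show "1 + y \<in> K" if "y \<in> K" for y
      using that hom(1,2) by (auto simp: K_def) (metis rangeI)
  qed
  have frob1: "(1 + b) ^ q = 1 + b ^ q" for b :: 'e
    by (rule one_add_power_card_subfield[OF K]) (use q1 in auto)
  have x0: "x \<noteq> 0" using x(2) by auto
  \<comment> \<open>Additivity of the \<open>q\<close>-th power is known only for sums
    \<open>1 + b\<close>, so \<open>x\<close> is factored out first.\<close>
  have "(x + x ^ q) = x * (1 + x ^ (q - 1))"
    using q1 by (simp add: algebra_simps flip: power_Suc)
  then have "(x + x ^ q) ^ q = x ^ q * (1 + (x ^ (q - 1)) ^ q)" by (simp add: power_mult_distrib frob1)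
  also have "\<dots> = x ^ q + (x * x ^ (q - 1)) ^ q" by (simp add: algebra_simps power_mult_distrib)
  also have "x * x ^ (q - 1) = x ^ q" using q1 by (simp flip: power_Suc)
  also have "(x ^ q) ^ q = x"
    using finite_field_power_card_eq_same[of x] E by (simp add: power2_eq_square power_mult)
  finally have "(x + x ^ q) ^ q = x + x ^ q" by (simp add: add.commute)
  then have "x + x ^ q \<in> K" using power_card_fixed_in_subfield[OF K(1-3) q1] by blast
  then obtain t where t: "x + x ^ q = \<iota> t" by (auto simp: K_def)
  then have inv: "the_inv \<iota> (x + x ^ q) = t" by (simp add: the_inv_f_f inj)
  have "t ^ 2 \<noteq> 4"
  proof
    assume "t ^ 2 = 4"
    \<comment> \<open>Writing 4 in terms of 1 lets \<open>\<iota>\<close> be applied through its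
      values on 1, sums and products.\<close>
    then have "t ^ 2 = (1 + 1) * (1 + 1)" by simp
    then have "\<iota> t ^ 2 = (1 + 1) * (1 + 1)" using hom by (metis pow)
    then have "(x + x ^ q) ^ 2 = 4 * (x * x ^ q)" using t x(2) by simp
    then have "(x - x ^ q) ^ 2 = 0" by (simp add: power2_eq_square algebra_simps)
    then have "x ^ q = x" by simp
    then have "x \<in> K" using power_card_fixed_in_subfield[OF K(1-3) q1] by blast
    then show False using x(1) by (simp add: K_def)
  qed
  then show ?thesis using inv by simp
qed

lemma conjugate_companion_inverse:
  fixes t :: "'f::finite_field"
  assumes "odd (CARD('f))" "t ^ 2 \<noteq> 4"
  defines "g \<equiv> vector [vector [0, -1], vector [1, t]] :: 'f ^ 2 ^ 2"
  shows "g \<in> carrier SL2" and "g \<noteq> inv\<^bsub>SL2\<^esub> g"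
    and "\<exists>h\<in>carrier SL2. conjugate_by SL2 h g = inv\<^bsub>SL2\<^esub> g"
proof -
  interpret group "SL2 :: ('f ^ 2 ^ 2) monoid" by (rule group_SL2)
  define g' :: "'f ^ 2 ^ 2" where "g' = vector [vector [t, 1], vector [-1, 0]]"
  have car: "g \<in> carrier SL2" "g' \<in> carrier SL2"
    by (simp_all add: SL2_def g_def g'_def det_2)
  have "g' \<otimes>\<^bsub>SL2\<^esub> g = \<one>\<^bsub>SL2\<^esub>"
    by (simp add: SL2_def g_def g'_def vec_eq_iff forall_2 matrix_matrix_mult_def sum_2 mat_def)
  then have inv: "inv\<^bsub>SL2\<^esub> g = g'" using car by (simp add: inv_equality)
  show "g \<in> carrier SL2" by (rule car(1))
  have "(1::'f) \<noteq> -1"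
  proof
    assume "(1::'f) = -1"
    then have "(2::'f) = 0" by (metis add.right_inverse one_add_one)
    then show False using finite_field_two_neq_0[OF assms(1)] by simp
  qed
  then have "g $ 2 $ 1 \<noteq> g' $ 2 $ 1" by (simp add: g_def g'_def)
  then show "g \<noteq> inv\<^bsub>SL2\<^esub> g" using inv by auto
  \<comment> \<open>The element \<open>a + b g\<close> commutes with \<open>g\<close>; its
    determinant -1 compensates that of the coordinate swap.\<close>
  obtain a b where ab: "a ^ 2 + t * a * b + b ^ 2 = (-1::'f)"
    using finite_field_norm_form_universal[OF assms(1,2)] by blast
  \<comment> \<open>\<open>h = (a + b g) w\<close> with \<open>w\<close> the swap of the coordinates, which inverts \<open>g\<close> but has determinant \<open>-1\<close>\<close>
  define h :: "'f ^ 2 ^ 2" where "h = vector [vector [- b, a], vector [a + b * t, b]]"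
  have "det h = - (a ^ 2 + t * a * b + b ^ 2)"
    by (simp add: h_def det_2 algebra_simps power2_eq_square)
  then have h: "h \<in> carrier SL2" by (simp add: SL2_def ab)
  have "h \<otimes>\<^bsub>SL2\<^esub> g = g' \<otimes>\<^bsub>SL2\<^esub> h"
    by (simp add: SL2_def g_def g'_def h_def vec_eq_iff forall_2 matrix_matrix_mult_def sum_2 algebra_simps)
  then have "conjugate_by SL2 h g = inv\<^bsub>SL2\<^esub> g"
    using h car by (simp add: conjugate_by_def inv m_assoc)
  with h show "\<exists>h\<in>carrier SL2. conjugate_by SL2 h g = inv\<^bsub>SL2\<^esub> g" by blast
qed

section \<open>Yetter-Drinfeld modules of real classes\<close>

lemma (in group) subgroup_centralizer:
  assumes "g \<in> carrier G"
  shows "subgroup (centralizer G g) G"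
proof (rule subgroupI)
  show "centralizer G g \<subseteq> carrier G" "centralizer G g \<noteq> {}"
    using assms by (auto simp: centralizer_def)
next
  fix h assume "h \<in> centralizer G g"
  then have h: "h \<in> carrier G" "h \<otimes> g = g \<otimes> h" by (auto simp: centralizer_def)
  have "inv h \<otimes> g = g \<otimes> inv h"
    by (metis h assms inv_closed inv_solve_left inv_solve_right m_assoc m_closed)
  then show "inv h \<in> centralizer G g" using h by (simp add: centralizer_def)
next
  fix h k assume "h \<in> centralizer G g" "k \<in> centralizer G g"
  then have hk: "h \<in> carrier G" "h \<otimes> g = g \<otimes> h" "k \<in> carrier G" "k \<otimes> g = g \<otimes> k"
    by (auto simp: centralizer_def)
  then have "h \<otimes> k \<otimes> g = g \<otimes> (h \<otimes> k)"
    by (metis assms m_assoc)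
  then show "h \<otimes> k \<in> centralizer G g" using hk by (simp add: centralizer_def)
qed

lemma (in group) conjugate_by_inverse:
  assumes "y \<in> carrier G" "g \<in> carrier G" "conjugate_by G y g = u"
  shows "u \<in> carrier G" "inv y \<otimes> u \<otimes> y = g" "inv y \<otimes> inv u \<otimes> y = inv g"
proof -
  show u: "u \<in> carrier G" using assms by (auto simp: conjugate_by_def)
  have "u = y \<otimes> (g \<otimes> inv y)" using assms by (simp add: conjugate_by_def m_assoc)
  then have *: "inv y \<otimes> u \<otimes> y = g \<otimes> inv y \<otimes> y" using assms by (simp flip: m_assoc)
  also have "\<dots> = g" using assms by (simp add: m_assoc)
  finally show "inv y \<otimes> u \<otimes> y = g" .
  then have "inv (inv y \<otimes> u \<otimes> y) = inv g" by simp
  then show "inv y \<otimes> inv u \<otimes> y = inv g"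
    using assms u by (simp add: inv_mult_group m_assoc)
qed

lemma character_values:
  fixes G (structure) and chi :: "'g \<Rightarrow> 'k::field"
  assumes "group G" and Z: "subgroup Z G" and chi: "chi \<in> characters G Z"
  shows "\<And>a b. a \<in> Z \<Longrightarrow> b \<in> Z \<Longrightarrow> chi (a \<otimes> b) = chi a * chi b"
    and "chi \<one> = 1"
    and "\<And>a. a \<in> Z \<Longrightarrow> chi a * chi (inv a) = 1"
proof -
  interpret group G by fact
  interpret Z: subgroup Z G by fact
  show mult: "chi (a \<otimes> b) = chi a * chi b" if "a \<in> Z" "b \<in> Z" for a b
    using chi that by (simp add: characters_def hom_def units_group_def)
  have "chi \<one> \<noteq> 0"
    using chi by (auto simp: characters_def hom_def units_group_def)
  moreover have "chi \<one> * chi \<one> = chi \<one>" using mult[of \<one> \<one>] by simp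
  ultimately show one: "chi \<one> = 1" by simp
  show "chi a * chi (inv a) = 1" if "a \<in> Z" for a
    using mult[of a "inv a"] that one by simp
qed

lemma coset_rep_mem:
  fixes G (structure)
  assumes "group G" "subgroup Z G" "h \<in> carrier G"
  shows "coset_rep G Z h \<in> h <# Z"
  unfolding coset_rep_def
proof (rule someI)
  interpret group G by fact
  interpret Z: subgroup Z G by fact
  show "h \<in> h <# Z" using assms(3) Z.one_closed by (force simp: l_coset_def)
qed

text \<open>The chosen representative depends only on the coset as a set. Basis elements are
  therefore their own representatives.\<close>

lemma coset_rep_idem:
  fixes G (structure)
  assumes "group G" "subgroup Z G" "h \<in> carrier G"
  shows "coset_rep G Z (coset_rep G Z h) = coset_rep G Z h"
proof -
  interpret group G by fact
  have "h <# Z = coset_rep G Z h <# Z"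
    by (rule l_repr_independence[OF coset_rep_mem[OF assms] assms(3,2)])
  then show ?thesis by (metis coset_rep_def)
qed

text \<open>The degree of \<open>a\<close> times \<open>b\<close> equals
  \<open>b \<otimes> z\<close> with \<open>z\<close> in the centralizer, so it acts on the basis
  vector of \<open>b\<close> by the scalar \<open>chi z\<close>.\<close>

lemma V_braiding_diagonal:
  fixes G (structure) and chi :: "'g \<Rightarrow> 'k::field"
  assumes "group G" "g \<in> carrier G" and chi: "chi \<in> characters G (centralizer G g)"
    and a: "a \<in> carrier G" and b: "b \<in> carrier G" "coset_rep G (centralizer G g) b = b"
    and Z: "inv b \<otimes> conjugate_by G a g \<otimes> b \<in> centralizer G g"
  shows "V_braiding G g chi a b = Poly_Mapping.single [b, a] (chi (inv b \<otimes> conjugate_by G a g \<otimes> b))"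
proof -
  interpret group G by fact
  note sub = subgroup_centralizer[OF assms(2)]
  define z where "z = inv b \<otimes> conjugate_by G a g \<otimes> b"
  have car: "conjugate_by G a g \<in> carrier G" using a assms(2) by (simp add: conjugate_by_def)
  have "conjugate_by G a g \<otimes> b = b \<otimes> z"
    unfolding z_def using b(1) car by (simp add: m_assoc[symmetric])
  moreover have "induced_vec G (centralizer G g) chi (b \<otimes> z) =
      fscale (chi z) (induced_vec G (centralizer G g) chi b)"
    using Z by (intro induced_vec_mult_right[OF assms(1) sub chi b(1)]) (simp add: z_def)
  moreover have "induced_vec G (centralizer G g) chi b = Poly_Mapping.single b 1"
    using b character_values(2)[OF assms(1) sub chi] by (simp add: induced_vec_def)
  ultimately show ?thesis
    by (simp add: V_braiding_def yd_braiding_def z_def)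
qed

text \<open>The cosets of \<open>\<one>\<close> and \<open>h\<close> give basis vectors of degrees
  \<open>g\<close> and \<open>inv g\<close>. They span a braided plane of diagonal type to which
  both obstructions apply: one leaves \<open>chi g\<close> equal to 1 or -1, the other excludes
  1.\<close>

lemma nichols_finite_dim_real_class:
  fixes G (structure) and chi :: "'g \<Rightarrow> 'k::field_char_0"
  assumes "group G" and g: "g \<in> carrier G" "g \<noteq> inv g"
    and h: "h \<in> carrier G" "conjugate_by G h g = inv g"
    and chi: "chi \<in> characters G (centralizer G g)"
    and fin: "nichols_finite_dim (V_basis G g) (V_braiding G g chi)"
  shows "chi g = -1"
proof -
  interpret group G by fact
  define Z where "Z = centralizer G g"
  have Z: "subgroup Z G" unfolding Z_def by (rule subgroup_centralizer) fact
  have Z_sub: "w \<in> carrier G" if "w \<in> Z" for w using that by (simp add: Z_def centralizer_def)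
  have chiZ: "chi \<in> characters G Z" using chi by (simp add: Z_def)
  note rep = coset_rep_mem[OF assms(1) Z]
  note idem = coset_rep_idem[OF assms(1) Z]
  note val = character_values[OF assms(1) Z chiZ]
  have "g \<in> Z" using g(1) by (simp add: Z_def centralizer_def)
  then have gZ: "g \<in> Z" "inv g \<in> Z" using subgroup.m_inv_closed[OF Z] by auto
  \<comment> \<open>The chosen representatives differ from \<open>\<one>\<close> and
    \<open>h\<close> by elements of \<open>Z\<close>, which does not affect the conjugates of
    \<open>g\<close>.\<close>
  define r where "r = coset_rep G Z \<one>"
  define s where "s = coset_rep G Z h"
  have r: "r \<in> Z" using rep[of \<one>] Z_sub by (auto simp: r_def l_coset_def)
  obtain z where z: "z \<in> Z" "s = h \<otimes> z" using rep[OF h(1)] by (auto simp: s_def l_coset_def)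
  have car: "r \<in> carrier G" "s \<in> carrier G" using r z h Z_sub by auto
  have fix_rep: "coset_rep G Z r = r" "coset_rep G Z s = s"
    unfolding r_def s_def using idem h(1) by auto
  have cz: "conjugate_by G w g = g" if "w \<in> Z" for w
    using that g(1) by (simp add: Z_def centralizer_def conjugate_by_def m_assoc)
  have dr: "conjugate_by G r g = g" by (rule cz[OF r])
  have "conjugate_by G s g = conjugate_by G h (conjugate_by G z g)"
    using z h(1) g(1) Z_sub by (simp add: conjugate_by_def inv_mult_group m_assoc)
  then have ds: "conjugate_by G s g = inv g" using cz[OF z(1)] h(2) by simp
  \<comment> \<open>The two basis vectors are distinct because their degrees \<open>g\<close> and
    \<open>inv g\<close> are.\<close>
  have rs: "r \<noteq> s" using dr ds g(2) by metis
  have t: "inv r \<otimes> g \<otimes> r = g" "inv r \<otimes> inv g \<otimes> r = inv g"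
    "inv s \<otimes> inv g \<otimes> s = g" "inv s \<otimes> g \<otimes> s = inv g"
    using conjugate_by_inverse[OF car(1) g(1) dr] conjugate_by_inverse[OF car(2) g(1) ds] g(1) by auto
  define q where "q a b = chi (inv b \<otimes> conjugate_by G a g \<otimes> b)" for a b
  have q: "q r r = chi g" "q r s = chi (inv g)" "q s r = chi (inv g)" "q s s = chi g"
    using t by (simp_all add: q_def dr ds)
  have diag: "V_braiding G g chi a b = Poly_Mapping.single [b, a] (q a b)"
    if "a \<in> {r, s}" "b \<in> {r, s}" for a b
    unfolding q_def
    by (rule V_braiding_diagonal[OF assms(1) g(1) chi])
      (use that car fix_rep gZ t dr ds in \<open>auto simp: Z_def\<close>)
  have basis: "r \<in> V_basis G g" "s \<in> V_basis G g"
    using h(1) by (auto simp: V_basis_def induced_basis_def r_def s_def Z_def)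
  have one: "chi g * chi (inv g) = 1" by (rule val(3)[OF gZ(1)])
  have "q r r * q r s * q s r * q s s = 1"
  proof -
    have "q r r * q r s * q s r * q s s = (chi g * chi (inv g)) * (chi g * chi (inv g))"
      by (simp add: q)
    then show ?thesis by (simp add: one)
  qed
  then have "q r s * q s r = 1"
    by (intro nichols_finite_dim_diagonal_eq_1[OF fin basis rs diag])
  then have "chi (inv g) * chi (inv g) = 1" by (simp add: q)
  then have "chi g * chi g = 1" using one by (metis mult.assoc mult.left_commute mult_1_right)
  then have "chi g = 1 \<or> chi g = -1" by (simp add: square_eq_1_iff)
  moreover have "chi g \<noteq> 1"
    using nichols_finite_dim_diagonal_neq_1[where q = q, OF fin basis(1)] diag[of r r] q(1) by simp
  ultimately show ?thesis by blast
qed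

text \<open>Applying \<open>chi\<close> to \<open>g\<close> raised to its order gives a power of -1
  equal to 1, and 1 differs from -1 in characteristic 0.\<close>

lemma even_ord_of_character:
  fixes G (structure) and chi :: "'g \<Rightarrow> 'k::field_char_0"
  assumes "group G" "subgroup Z G" "chi \<in> characters G Z" "g \<in> Z" "chi g = -1"
  shows "even (group.ord G g)"
proof -
  interpret group G by fact
  interpret Z: subgroup Z G by fact
  note val = character_values[OF assms(1-3)]
  have "g [^] n \<in> Z \<and> chi (g [^] n) = (-1) ^ n" for n :: nat
    by (induction n) (use assms(4,5) val in auto)
  then have "(-1 :: 'k) ^ ord g = 1"
    using val(2) assms(4) by (metis pow_ord_eq_1 Z.mem_carrier)
  then show ?thesis by (metis minus_one_power_iff one_neq_neg_one)
qed

theorem proposition3p5: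
  fixes \<iota> :: "'f::finite_field \<Rightarrow> 'e::finite_field" and q :: nat and x :: 'e
    and g :: "'f ^ 2 ^ 2"
  assumes "CARD('f) = q" and "odd q" and "q > 3" and "CARD('e) = q ^ 2"
    and "\<iota> 1 = 1" and "\<And>a b. \<iota> (a + b) = \<iota> a + \<iota> b" and "\<And>a b. \<iota> (a * b) = \<iota> a * \<iota> b"
    and "x \<notin> range \<iota>" and "x * x ^ q = 1"
    and "g = c8 \<iota> x"
  shows "(\<exists>h\<in>carrier SL2. conjugate_by SL2 h g = inv\<^bsub>SL2\<^esub> g) \<and>
    (\<forall>chi \<in> characters SL2 (centralizer SL2 g) :: ('f ^ 2 ^ 2 \<Rightarrow> 'k::{alg_closed_field, field_char_0}) set.
      nichols_finite_dim (V_basis SL2 g) (V_braiding SL2 g chi) \<longrightarrow>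
      (let t = vector [g, inv\<^bsub>SL2\<^esub> g] :: ('f ^ 2 ^ 2) ^ 2 in
        \<forall>y. (\<forall>i. y i \<in> carrier SL2 \<and> conjugate_by SL2 (y i) g = t $ i) \<longrightarrow>
          q_matrix SL2 chi t y = vector [vector [-1, -1], vector [-1, -1]]) \<and>
      even (group.ord SL2 g))"
proof -
  interpret group "SL2 :: ('f ^ 2 ^ 2) monoid" by (rule group_SL2)
  define \<tau> where "\<tau> = the_inv \<iota> (x + x ^ q)"
  have "\<tau> ^ 2 \<noteq> 4" unfolding \<tau>_def by (rule norm_one_trace) (use assms in auto)
  moreover have "odd (CARD('f))" using assms(1,2) by simp
  moreover have "g = vector [vector [0, -1], vector [1, \<tau>]]"
    using assms(1,10) by (simp add: c8_def \<tau>_def)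
  ultimately have g: "g \<in> carrier SL2" "g \<noteq> inv\<^bsub>SL2\<^esub> g"
    and conj: "\<exists>h\<in>carrier SL2. conjugate_by SL2 h g = inv\<^bsub>SL2\<^esub> g"
    using conjugate_companion_inverse[of \<tau>] by auto
  then obtain h where h: "h \<in> carrier SL2" "conjugate_by SL2 h g = inv\<^bsub>SL2\<^esub> g" by blast
  note Z = subgroup_centralizer[OF g(1)]
  have gZ: "g \<in> centralizer SL2 g" using g(1) by (simp add: centralizer_def)
  \<comment> \<open>For any conjugating family \<open>y\<close>, the argument of \<open>chi\<close>
    is \<open>g\<close> on the diagonal and the inverse of \<open>g\<close> off it; both have value
    -1.\<close>
  have "q_matrix SL2 chi t y = vector [vector [-1, -1], vector [-1, -1]]"
    if chi: "chi \<in> characters SL2 (centralizer SL2 g)" and val: "chi g = -1"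
      and t: "t = vector [g, inv\<^bsub>SL2\<^esub> g]"
      and y: "\<And>i. y i \<in> carrier SL2" "\<And>i. conjugate_by SL2 (y i) g = t $ i"
    for chi :: "'f ^ 2 ^ 2 \<Rightarrow> 'k" and t :: "('f ^ 2 ^ 2) ^ 2" and y
  proof -
    have "chi (inv\<^bsub>SL2\<^esub> g) = -1"
      using character_values(3)[OF group_SL2 Z chi gZ] val by (simp add: minus_equation_iff)
    moreover note conjugate_by_inverse[OF y(1)[of 1] g(1) y(2)] conjugate_by_inverse[OF y(1)[of 2] g(1) y(2)]
    ultimately have "\<forall>i j. chi (inv\<^bsub>SL2\<^esub> (y j) \<otimes>\<^bsub>SL2\<^esub> t $ i \<otimes>\<^bsub>SL2\<^esub> y j) = -1"
      using val g(1) by (simp add: forall_2 t)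
    then show ?thesis
      by (simp add: q_matrix_def vec_eq_iff[where 'a = 'k] vec_eq_iff[where 'a = "'k ^ 2"] forall_2)
  qed
  moreover have "chi g = -1"
    if "chi \<in> characters SL2 (centralizer SL2 g)"
      "nichols_finite_dim (V_basis SL2 g) (V_braiding SL2 g chi)" for chi :: "'f ^ 2 ^ 2 \<Rightarrow> 'k"
    by (rule nichols_finite_dim_real_class[OF group_SL2 g h that])
  ultimately show ?thesis
    using conj even_ord_of_character[OF group_SL2 Z _ gZ] unfolding Let_def by blast
qed

end
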